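(* Let $\mathscr K$ be a tt-category, and let $f:A\to B$ and $g:B\to A$ be homomorphisms of tt-rings in $\mathscr K$ such that $g\circ f=\mathrm{id}_A$. Then there exist a tt-ring $C$ in $\mathscr K$ and a ring isomorphism $h:B\xrightarrow{\sim}A\times C$ such that $\mathrm{pr}_1\circ h=g$. Consequently, $C$ becomes an $A$-algebra via $\mathrm{pr}_2\circ h\circ f:A\to C$. Moreover, if $C'$ is another $A$-algebra and $h':B\xrightarrow{\sim}A\times C'$ is another isomorphism of $A$-algebras such that $\mathrm{pr}_1\circ h'=g$ (where $B$ is an $A$-algebra via $f$), then there exists an isomorphism of $A$-algebras $\ell:C\xrightarrow{\sim}C'$ such that $h'=(1\times\ell)\circ h$.
   Context: A tt-category is an essentially small, idempotent-complete triangulated category $\mathscr K$ with a symmetric monoidal structure $(\otimes,\mathbb 1)$ such that $\otimes$ is exact in each variable. A ring object in $\mathscr K$ is an associative unital monoid $(A,\mu:A\otimes A\to A,\eta:\mathbb 1\to A)$. It is separable if $\mu$ admits a section $\sigma:A\to A\otimes A$ (i.e. $\mu\sigma=\mathrm{id}_A$) which is a morphism of $A,A$-bimodules. A tt-ring is a commutative separable ring object. Homomorphisms of ring objects are morphisms compatible with multiplications and units. The product $A\times C$ of ring objects is $A\oplus C$ with component-wise structure, with projections $\mathrm{pr}_1,\mathrm{pr}_2$. For a tt-ring $A$, an $A$-algebra is a tt-ring $D$ in $\mathscr K$ with a homomorphism of tt-rings $A\to D$; morphisms of $A$-algebras are ring homomorphisms compatible with the homomorphisms from $A$. The product $A\times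 C'$ is an $A$-algebra via $\mathrm{id}_A$ and the structure homomorphism $A\to C'$. *)

theory Defs
  imports "HOL-Algebra.Group"
begin

section \<open>Categories and endofunctors\<close>

text \<open>
  The objects and the morphisms of a category are subsets \<open>ob\<close>, \<open>mor\<close> of two types;
  composition \<open>g \<cdot> f\<close> is in the order of function composition and is only meaningful when
  \<open>tgt f = src g\<close>.  Since the objects and the morphisms form sets in the sense of HOL,
  every such category is small, hence essentially small.
\<close>

record ('o, 'm) category =
  ob :: "'o set"
  mor :: "'m set"
  src :: "'m \<Rightarrow> 'o"
  tgt :: "'m \<Rightarrow> 'o"
  ident :: "'o \<Rightarrow> 'm" ("idm\<index>")
  compose :: "'m \<Rightarrow> 'm \<Rightarrow> 'm" (infixr "\<cdot>\<index>" 70)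

definition Hom :: "('o, 'm, 'z) category_scheme \<Rightarrow> 'o \<Rightarrow> 'o \<Rightarrow> 'm set" where
  "Hom K a b = {f \<in> mor K. src K f = a \<and> tgt K f = b}"

locale category =
  fixes K :: "('o, 'm, 'z) category_scheme" (structure)
  assumes src_ob: "f \<in> mor K \<Longrightarrow> src K f \<in> ob K"
    and tgt_ob: "f \<in> mor K \<Longrightarrow> tgt K f \<in> ob K"
    and ident_Hom: "a \<in> ob K \<Longrightarrow> idm a \<in> Hom K a a"
    and compose_Hom: "\<lbrakk>f \<in> Hom K a b; g \<in> Hom K b c\<rbrakk> \<Longrightarrow> g \<cdot> f \<in> Hom K a c"
    and compose_ident_right: "f \<in> Hom K a b \<Longrightarrow> f \<cdot> idm a = f"
    and compose_ident_left: "f \<in> Hom K a b \<Longrightarrow> idm b \<cdot> f = f"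
    and compose_assoc:
      "\<lbrakk>f \<in> Hom K a b; g \<in> Hom K b c; h \<in> Hom K c d\<rbrakk> \<Longrightarrow> (h \<cdot> g) \<cdot> f = h \<cdot> (g \<cdot> f)"

definition inverse_mors :: "('o, 'm, 'z) category_scheme \<Rightarrow> 'm \<Rightarrow> 'm \<Rightarrow> bool" where
  "inverse_mors K f g \<longleftrightarrow>
     f \<in> mor K \<and> g \<in> Hom K (tgt K f) (src K f) \<and>
     g \<cdot>\<^bsub>K\<^esub> f = idm\<^bsub>K\<^esub> (src K f) \<and> f \<cdot>\<^bsub>K\<^esub> g = idm\<^bsub>K\<^esub> (tgt K f)"

definition isomorphism :: "('o, 'm, 'z) category_scheme \<Rightarrow> 'm \<Rightarrow> bool" where
  "isomorphism K f \<longleftrightarrow> (\<exists>g. inverse_mors K f g)"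

definition inv_mor :: "('o, 'm, 'z) category_scheme \<Rightarrow> 'm \<Rightarrow> 'm" where
  "inv_mor K f = (THE g. inverse_mors K f g)"

definition idempotent_complete :: "('o, 'm, 'z) category_scheme \<Rightarrow> bool" where
  "idempotent_complete K \<longleftrightarrow>
     (\<forall>a \<in> ob K. \<forall>e \<in> Hom K a a. e \<cdot>\<^bsub>K\<^esub> e = e \<longrightarrow>
        (\<exists>b \<in> ob K. \<exists>r \<in> Hom K a b. \<exists>i \<in> Hom K b a. i \<cdot>\<^bsub>K\<^esub> r = e \<and> r \<cdot>\<^bsub>K\<^esub> i = idm\<^bsub>K\<^esub> b))"

definition endofunctor ::
    "('o, 'm, 'z) category_scheme \<Rightarrow> ('o \<Rightarrow> 'o) \<Rightarrow> ('m \<Rightarrow> 'm) \<Rightarrow> bool" where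
  "endofunctor K Fo Fm \<longleftrightarrow>
     (\<forall>a \<in> ob K. Fo a \<in> ob K) \<and>
     (\<forall>a \<in> ob K. \<forall>b \<in> ob K. \<forall>f \<in> Hom K a b. Fm f \<in> Hom K (Fo a) (Fo b)) \<and>
     (\<forall>a \<in> ob K. Fm (idm\<^bsub>K\<^esub> a) = idm\<^bsub>K\<^esub> (Fo a)) \<and>
     (\<forall>f \<in> mor K. \<forall>g \<in> mor K. tgt K f = src K g \<longrightarrow> Fm (g \<cdot>\<^bsub>K\<^esub> f) = Fm g \<cdot>\<^bsub>K\<^esub> Fm f)"

definition natural_iso ::
    "('o, 'm, 'z) category_scheme \<Rightarrow> ('o \<Rightarrow> 'o) \<Rightarrow> ('m \<Rightarrow> 'm) \<Rightarrow> ('o \<Rightarrow> 'o) \<Rightarrow> ('m \<Rightarrow> 'm) \<Rightarrow>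
      ('o \<Rightarrow> 'm) \<Rightarrow> bool" where
  "natural_iso K Fo Fm Go Gm t \<longleftrightarrow>
     (\<forall>a \<in> ob K. t a \<in> Hom K (Fo a) (Go a) \<and> isomorphism K (t a)) \<and>
     (\<forall>f \<in> mor K. t (tgt K f) \<cdot>\<^bsub>K\<^esub> Fm f = Gm f \<cdot>\<^bsub>K\<^esub> t (src K f))"

definition autoequivalence ::
    "('o, 'm, 'z) category_scheme \<Rightarrow> ('o \<Rightarrow> 'o) \<Rightarrow> ('m \<Rightarrow> 'm) \<Rightarrow> bool" where
  "autoequivalence K Fo Fm \<longleftrightarrow>
     endofunctor K Fo Fm \<and>
     (\<exists>Go Gm s t. endofunctor K Go Gm \<and>
        natural_iso K (Go \<circ> Fo) (Gm \<circ> Fm) (\<lambda>a. a) (\<lambda>f. f) s \<and>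
        natural_iso K (Fo \<circ> Go) (Fm \<circ> Gm) (\<lambda>a. a) (\<lambda>f. f) t)"


section \<open>Additive categories\<close>

record ('o, 'm) preadditive_category = "('o, 'm) category" +
  zero_mor :: "'o \<Rightarrow> 'o \<Rightarrow> 'm"
  add_mor :: "'m \<Rightarrow> 'm \<Rightarrow> 'm" (infixl "\<boxplus>\<index>" 65)

definition Hom_group ::
    "('o, 'm, 'z) preadditive_category_scheme \<Rightarrow> 'o \<Rightarrow> 'o \<Rightarrow> 'm monoid" where
  "Hom_group K a b =
     \<lparr>carrier = Hom K a b, monoid.mult = add_mor K, one = zero_mor K a b\<rparr>"

definition neg_mor :: "('o, 'm, 'z) preadditive_category_scheme \<Rightarrow> 'm \<Rightarrow> 'm" where
  "neg_mor K f = inv\<^bsub>Hom_group K (src K f) (tgt K f)\<^esub> f"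

definition zero_object :: "('o, 'm, 'z) category_scheme \<Rightarrow> 'o \<Rightarrow> bool" where
  "zero_object K z \<longleftrightarrow>
     z \<in> ob K \<and> (\<forall>a \<in> ob K. (\<exists>!f. f \<in> Hom K a z) \<and> (\<exists>!f. f \<in> Hom K z a))"

definition is_biproduct ::
    "('o, 'm, 'z) preadditive_category_scheme \<Rightarrow> 'o \<Rightarrow> 'o \<Rightarrow> 'o \<times> 'm \<times> 'm \<times> 'm \<times> 'm \<Rightarrow> bool"
  where
  "is_biproduct K a b = (\<lambda>(s, i1, i2, p1, p2).
     s \<in> ob K \<and> i1 \<in> Hom K a s \<and> i2 \<in> Hom K b s \<and> p1 \<in> Hom K s a \<and> p2 \<in> Hom K s b \<and>
     p1 \<cdot>\<^bsub>K\<^esub> i1 = idm\<^bsub>K\<^esub> a \<and> p2 \<cdot>\<^bsub>K\<^esub> i2 = idm\<^bsub>K\<^esub> b \<and>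
     p2 \<cdot>\<^bsub>K\<^esub> i1 = zero_mor K a b \<and> p1 \<cdot>\<^bsub>K\<^esub> i2 = zero_mor K b a \<and>
     (i1 \<cdot>\<^bsub>K\<^esub> p1) \<boxplus>\<^bsub>K\<^esub> (i2 \<cdot>\<^bsub>K\<^esub> p2) = idm\<^bsub>K\<^esub> s)"

locale additive_category = category K
  for K :: "('o, 'm, 'z) preadditive_category_scheme" (structure) +
  assumes Hom_comm_group: "\<lbrakk>a \<in> ob K; b \<in> ob K\<rbrakk> \<Longrightarrow> comm_group (Hom_group K a b)"
    and compose_add_right:
      "\<lbrakk>f \<in> Hom K a b; f' \<in> Hom K a b; g \<in> Hom K b c\<rbrakk> \<Longrightarrow>
         g \<cdot> (f \<boxplus> f') = (g \<cdot> f) \<boxplus> (g \<cdot> f')"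
    and compose_add_left:
      "\<lbrakk>f \<in> Hom K a b; g \<in> Hom K b c; g' \<in> Hom K b c\<rbrakk> \<Longrightarrow>
         (g \<boxplus> g') \<cdot> f = (g \<cdot> f) \<boxplus> (g' \<cdot> f)"
    and ex_zero_object: "\<exists>z. zero_object K z"
    and ex_biproduct: "\<lbrakk>a \<in> ob K; b \<in> ob K\<rbrakk> \<Longrightarrow> \<exists>S. is_biproduct K a b S"

definition additive_endofunctor ::
    "('o, 'm, 'z) preadditive_category_scheme \<Rightarrow> ('o \<Rightarrow> 'o) \<Rightarrow> ('m \<Rightarrow> 'm) \<Rightarrow> bool" where
  "additive_endofunctor K Fo Fm \<longleftrightarrow>
     endofunctor K Fo Fm \<and>
     (\<forall>a \<in> ob K. \<forall>b \<in> ob K. \<forall>f \<in> Hom K a b. \<forall>g \<in> Hom K a b.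
        Fm (f \<boxplus>\<^bsub>K\<^esub> g) = Fm f \<boxplus>\<^bsub>K\<^esub> Fm g)"

text \<open>
  A direct sum \<open>a \<oplus> b\<close> is determined only up to unique isomorphism; we fix one arbitrary choice
  for each pair of objects.
\<close>

definition dsum_data ::
    "('o, 'm, 'z) preadditive_category_scheme \<Rightarrow> 'o \<Rightarrow> 'o \<Rightarrow> 'o \<times> 'm \<times> 'm \<times> 'm \<times> 'm" where
  "dsum_data K a b = (SOME S. is_biproduct K a b S)"

definition dsum :: "('o, 'm, 'z) preadditive_category_scheme \<Rightarrow> 'o \<Rightarrow> 'o \<Rightarrow> 'o" where
  "dsum K a b = (case dsum_data K a b of (s, i1, i2, p1, p2) \<Rightarrow> s)"

definition dsum_in1 :: "('o, 'm, 'z) preadditive_category_scheme \<Rightarrow> 'o \<Rightarrow> 'o \<Rightarrow> 'm" where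
  "dsum_in1 K a b = (case dsum_data K a b of (s, i1, i2, p1, p2) \<Rightarrow> i1)"

definition dsum_in2 :: "('o, 'm, 'z) preadditive_category_scheme \<Rightarrow> 'o \<Rightarrow> 'o \<Rightarrow> 'm" where
  "dsum_in2 K a b = (case dsum_data K a b of (s, i1, i2, p1, p2) \<Rightarrow> i2)"

definition dsum_pr1 :: "('o, 'm, 'z) preadditive_category_scheme \<Rightarrow> 'o \<Rightarrow> 'o \<Rightarrow> 'm" where
  "dsum_pr1 K a b = (case dsum_data K a b of (s, i1, i2, p1, p2) \<Rightarrow> p1)"

definition dsum_pr2 :: "('o, 'm, 'z) preadditive_category_scheme \<Rightarrow> 'o \<Rightarrow> 'o \<Rightarrow> 'm" where
  "dsum_pr2 K a b = (case dsum_data K a b of (s, i1, i2, p1, p2) \<Rightarrow> p2)"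

text \<open>The morphism \<open>(u, v) : x \<rightarrow> a \<oplus> b\<close> with components \<open>u : x \<rightarrow> a\<close> and \<open>v : x \<rightarrow> b\<close>.\<close>

definition dsum_pair :: "('o, 'm, 'z) preadditive_category_scheme \<Rightarrow> 'm \<Rightarrow> 'm \<Rightarrow> 'm" where
  "dsum_pair K u v =
     (dsum_in1 K (tgt K u) (tgt K v) \<cdot>\<^bsub>K\<^esub> u) \<boxplus>\<^bsub>K\<^esub> (dsum_in2 K (tgt K u) (tgt K v) \<cdot>\<^bsub>K\<^esub> v)"

text \<open>The morphism \<open>u \<times> v : a \<oplus> b \<rightarrow> a' \<oplus> b'\<close> for \<open>u : a \<rightarrow> a'\<close> and \<open>v : b \<rightarrow> b'\<close>.\<close>

definition dsum_map :: "('o, 'm, 'z) preadditive_category_scheme \<Rightarrow> 'm \<Rightarrow> 'm \<Rightarrow> 'm" where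
  "dsum_map K u v =
     dsum_pair K (u \<cdot>\<^bsub>K\<^esub> dsum_pr1 K (src K u) (src K v)) (v \<cdot>\<^bsub>K\<^esub> dsum_pr2 K (src K u) (src K v))"


section \<open>Triangulated categories\<close>

text \<open>
  The set \<open>dist\<close> contains the distinguished triangles \<open>a \<rightarrow> b \<rightarrow> c \<rightarrow> \<Sigma> a\<close>, each represented by its
  three morphisms.
\<close>

record ('o, 'm) triangulated_category = "('o, 'm) preadditive_category" +
  shift_ob :: "'o \<Rightarrow> 'o"
  shift_mor :: "'m \<Rightarrow> 'm"
  dist :: "('m \<times> 'm \<times> 'm) set"

definition triangle ::
    "('o, 'm, 'z) triangulated_category_scheme \<Rightarrow> 'o \<Rightarrow> 'o \<Rightarrow> 'o \<Rightarrow> 'm \<times> 'm \<times> 'm \<Rightarrow> bool" where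
  "triangle K a b c = (\<lambda>(f, g, h).
     a \<in> ob K \<and> b \<in> ob K \<and> c \<in> ob K \<and>
     f \<in> Hom K a b \<and> g \<in> Hom K b c \<and> h \<in> Hom K c (shift_ob K a))"

locale triangulated_category = additive_category K
  for K :: "('o, 'm, 'z) triangulated_category_scheme" (structure) +
  assumes shift_autoequivalence: "autoequivalence K (shift_ob K) (shift_mor K)"
    and shift_additive: "additive_endofunctor K (shift_ob K) (shift_mor K)"
    and dist_triangle: "T \<in> dist K \<Longrightarrow> \<exists>a b c. triangle K a b c T"
    and TR1_trivial:
      "\<lbrakk>a \<in> ob K; zero_object K z\<rbrakk> \<Longrightarrow>
         (idm a, zero_mor K a z, zero_mor K z (shift_ob K a)) \<in> dist K"
    and TR1_cone: "f \<in> mor K \<Longrightarrow> \<exists>g h. (f, g, h) \<in> dist K"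
    and TR1_iso:
      "\<lbrakk>(f, g, h) \<in> dist K; triangle K a b c (f, g, h); triangle K a' b' c' (f', g', h');
        u \<in> Hom K a a'; v \<in> Hom K b b'; w \<in> Hom K c c';
        isomorphism K u; isomorphism K v; isomorphism K w;
        v \<cdot> f = f' \<cdot> u; w \<cdot> g = g' \<cdot> v; shift_mor K u \<cdot> h = h' \<cdot> w\<rbrakk> \<Longrightarrow>
         (f', g', h') \<in> dist K"
    and TR2:
      "triangle K a b c (f, g, h) \<Longrightarrow>
         (f, g, h) \<in> dist K \<longleftrightarrow> (g, h, neg_mor K (shift_mor K f)) \<in> dist K"
    and TR3:
      "\<lbrakk>(f, g, h) \<in> dist K; triangle K a b c (f, g, h);
        (f', g', h') \<in> dist K; triangle K a' b' c' (f', g', h');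
        u \<in> Hom K a a'; v \<in> Hom K b b'; v \<cdot> f = f' \<cdot> u\<rbrakk> \<Longrightarrow>
         \<exists>w \<in> Hom K c c'. w \<cdot> g = g' \<cdot> v \<and> shift_mor K u \<cdot> h = h' \<cdot> w"
    and TR4:
      "\<lbrakk>(f, f1, f2) \<in> dist K; triangle K a b x (f, f1, f2);
        (g, g1, g2) \<in> dist K; triangle K b c y (g, g1, g2);
        (g \<cdot> f, k1, k2) \<in> dist K; triangle K a c z (g \<cdot> f, k1, k2)\<rbrakk> \<Longrightarrow>
         \<exists>u \<in> Hom K x z. \<exists>v \<in> Hom K z y.
           (u, v, shift_mor K f1 \<cdot> g2) \<in> dist K \<and>
           u \<cdot> f1 = k1 \<cdot> g \<and> k2 \<cdot> u = f2 \<and> v \<cdot> k1 = g1 \<and> g2 \<cdot> v = shift_mor K f \<cdot> k2"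

text \<open>
  An exact functor is an additive functor for which there is a natural isomorphism
  \<open>F \<Sigma> \<cong> \<Sigma> F\<close> such that \<open>F\<close> preserves distinguished triangles up to this identification.
\<close>

definition exact_endofunctor ::
    "('o, 'm, 'z) triangulated_category_scheme \<Rightarrow> ('o \<Rightarrow> 'o) \<Rightarrow> ('m \<Rightarrow> 'm) \<Rightarrow> bool" where
  "exact_endofunctor K Fo Fm \<longleftrightarrow>
     additive_endofunctor K Fo Fm \<and>
     (\<exists>t. natural_iso K (Fo \<circ> shift_ob K) (Fm \<circ> shift_mor K) (shift_ob K \<circ> Fo) (shift_mor K \<circ> Fm) t \<and>
        (\<forall>f g h. (f, g, h) \<in> dist K \<longrightarrow> (Fm f, Fm g, t (src K f) \<cdot>\<^bsub>K\<^esub> Fm h) \<in> dist K))"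


section \<open>Tensor-triangulated categories\<close>

text \<open>
  The structure isomorphisms are directed as follows: associator
  \<open>(a \<otimes> b) \<otimes> c \<rightarrow> a \<otimes> (b \<otimes> c)\<close>, left unitor \<open>\<one> \<otimes> a \<rightarrow> a\<close>, right unitor \<open>a \<otimes> \<one> \<rightarrow> a\<close>,
  symmetry \<open>a \<otimes> b \<rightarrow> b \<otimes> a\<close>.
\<close>

record ('o, 'm) tt_category = "('o, 'm) triangulated_category" +
  tensor_ob :: "'o \<Rightarrow> 'o \<Rightarrow> 'o" (infixl "\<otimes>\<^sub>o\<index>" 75)
  tensor_mor :: "'m \<Rightarrow> 'm \<Rightarrow> 'm" (infixl "\<otimes>\<^sub>m\<index>" 75)
  unit_ob :: "'o"
  associator :: "'o \<Rightarrow> 'o \<Rightarrow> 'o \<Rightarrow> 'm"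
  lunitor :: "'o \<Rightarrow> 'm"
  runitor :: "'o \<Rightarrow> 'm"
  symmetry :: "'o \<Rightarrow> 'o \<Rightarrow> 'm"

locale symmetric_monoidal_category = category K
  for K :: "('o, 'm, 'z) tt_category_scheme" (structure) +
  assumes unit_ob: "unit_ob K \<in> ob K"
    and tensor_ob: "\<lbrakk>a \<in> ob K; b \<in> ob K\<rbrakk> \<Longrightarrow> a \<otimes>\<^sub>o b \<in> ob K"
    and tensor_mor_Hom:
      "\<lbrakk>f \<in> Hom K a b; g \<in> Hom K c d\<rbrakk> \<Longrightarrow> f \<otimes>\<^sub>m g \<in> Hom K (a \<otimes>\<^sub>o c) (b \<otimes>\<^sub>o d)"
    and tensor_ident: "\<lbrakk>a \<in> ob K; b \<in> ob K\<rbrakk> \<Longrightarrow> idm a \<otimes>\<^sub>m idm b = idm (a \<otimes>\<^sub>o b)"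
    and tensor_compose:
      "\<lbrakk>f \<in> Hom K a b; f' \<in> Hom K b c; g \<in> Hom K x y; g' \<in> Hom K y z\<rbrakk> \<Longrightarrow>
         (f' \<cdot> f) \<otimes>\<^sub>m (g' \<cdot> g) = (f' \<otimes>\<^sub>m g') \<cdot> (f \<otimes>\<^sub>m g)"
    and associator_Hom:
      "\<lbrakk>a \<in> ob K; b \<in> ob K; c \<in> ob K\<rbrakk> \<Longrightarrow>
         associator K a b c \<in> Hom K ((a \<otimes>\<^sub>o b) \<otimes>\<^sub>o c) (a \<otimes>\<^sub>o (b \<otimes>\<^sub>o c))"
    and associator_iso:
      "\<lbrakk>a \<in> ob K; b \<in> ob K; c \<in> ob K\<rbrakk> \<Longrightarrow> isomorphism K (associator K a b c)"
    and associator_natural: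
      "\<lbrakk>f \<in> Hom K a a'; g \<in> Hom K b b'; h \<in> Hom K c c'\<rbrakk> \<Longrightarrow>
         associator K a' b' c' \<cdot> ((f \<otimes>\<^sub>m g) \<otimes>\<^sub>m h) = (f \<otimes>\<^sub>m (g \<otimes>\<^sub>m h)) \<cdot> associator K a b c"
    and lunitor_Hom: "a \<in> ob K \<Longrightarrow> lunitor K a \<in> Hom K (unit_ob K \<otimes>\<^sub>o a) a"
    and lunitor_iso: "a \<in> ob K \<Longrightarrow> isomorphism K (lunitor K a)"
    and lunitor_natural:
      "f \<in> Hom K a b \<Longrightarrow> lunitor K b \<cdot> (idm (unit_ob K) \<otimes>\<^sub>m f) = f \<cdot> lunitor K a"
    and runitor_Hom: "a \<in> ob K \<Longrightarrow> runitor K a \<in> Hom K (a \<otimes>\<^sub>o unit_ob K) a"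
    and runitor_iso: "a \<in> ob K \<Longrightarrow> isomorphism K (runitor K a)"
    and runitor_natural:
      "f \<in> Hom K a b \<Longrightarrow> runitor K b \<cdot> (f \<otimes>\<^sub>m idm (unit_ob K)) = f \<cdot> runitor K a"
    and symmetry_Hom:
      "\<lbrakk>a \<in> ob K; b \<in> ob K\<rbrakk> \<Longrightarrow> symmetry K a b \<in> Hom K (a \<otimes>\<^sub>o b) (b \<otimes>\<^sub>o a)"
    and symmetry_natural:
      "\<lbrakk>f \<in> Hom K a a'; g \<in> Hom K b b'\<rbrakk> \<Longrightarrow>
         symmetry K a' b' \<cdot> (f \<otimes>\<^sub>m g) = (g \<otimes>\<^sub>m f) \<cdot> symmetry K a b"
    and symmetry_involutive:
      "\<lbrakk>a \<in> ob K; b \<in> ob K\<rbrakk> \<Longrightarrow> symmetry K b a \<cdot> symmetry K a b = idm (a \<otimes>\<^sub>o b)"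
    and pentagon:
      "\<lbrakk>a \<in> ob K; b \<in> ob K; c \<in> ob K; d \<in> ob K\<rbrakk> \<Longrightarrow>
         (idm a \<otimes>\<^sub>m associator K b c d) \<cdot> associator K a (b \<otimes>\<^sub>o c) d \<cdot> (associator K a b c \<otimes>\<^sub>m idm d) =
         associator K a b (c \<otimes>\<^sub>o d) \<cdot> associator K (a \<otimes>\<^sub>o b) c d"
    and triangle_identity:
      "\<lbrakk>a \<in> ob K; b \<in> ob K\<rbrakk> \<Longrightarrow>
         (idm a \<otimes>\<^sub>m lunitor K b) \<cdot> associator K a (unit_ob K) b = runitor K a \<otimes>\<^sub>m idm b"
    and hexagon:
      "\<lbrakk>a \<in> ob K; b \<in> ob K; c \<in> ob K\<rbrakk> \<Longrightarrow>
         associator K b c a \<cdot> symmetry K a (b \<otimes>\<^sub>o c) \<cdot> associator K a b c =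
         (idm b \<otimes>\<^sub>m symmetry K a c) \<cdot> associator K b a c \<cdot> (symmetry K a b \<otimes>\<^sub>m idm c)"

locale tt_category = triangulated_category K + symmetric_monoidal_category K
  for K :: "('o, 'm, 'z) tt_category_scheme" (structure) +
  assumes idempotent_complete: "idempotent_complete K"
    and tensor_exact_right: "a \<in> ob K \<Longrightarrow> exact_endofunctor K (\<lambda>x. a \<otimes>\<^sub>o x) (\<lambda>f. idm a \<otimes>\<^sub>m f)"
    and tensor_exact_left: "a \<in> ob K \<Longrightarrow> exact_endofunctor K (\<lambda>x. x \<otimes>\<^sub>o a) (\<lambda>f. f \<otimes>\<^sub>m idm a)"


section \<open>Ring objects, tt-rings and algebras\<close>

record ('o, 'm) ring_obj =
  under :: 'o
  mul :: 'm
  unit :: 'm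

definition ring_object :: "('o, 'm, 'z) tt_category_scheme \<Rightarrow> ('o, 'm) ring_obj \<Rightarrow> bool" where
  "ring_object K A \<longleftrightarrow>
     under A \<in> ob K \<and>
     mul A \<in> Hom K (under A \<otimes>\<^sub>o\<^bsub>K\<^esub> under A) (under A) \<and>
     unit A \<in> Hom K (unit_ob K) (under A) \<and>
     mul A \<cdot>\<^bsub>K\<^esub> (mul A \<otimes>\<^sub>m\<^bsub>K\<^esub> idm\<^bsub>K\<^esub> (under A)) =
       mul A \<cdot>\<^bsub>K\<^esub> (idm\<^bsub>K\<^esub> (under A) \<otimes>\<^sub>m\<^bsub>K\<^esub> mul A) \<cdot>\<^bsub>K\<^esub> associator K (under A) (under A) (under A) \<and>
     mul A \<cdot>\<^bsub>K\<^esub> (unit A \<otimes>\<^sub>m\<^bsub>K\<^esub> idm\<^bsub>K\<^esub> (under A)) = lunitor K (under A) \<and>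
     mul A \<cdot>\<^bsub>K\<^esub> (idm\<^bsub>K\<^esub> (under A) \<otimes>\<^sub>m\<^bsub>K\<^esub> unit A) = runitor K (under A)"

definition commutative_ring_object ::
    "('o, 'm, 'z) tt_category_scheme \<Rightarrow> ('o, 'm) ring_obj \<Rightarrow> bool" where
  "commutative_ring_object K A \<longleftrightarrow>
     ring_object K A \<and> mul A \<cdot>\<^bsub>K\<^esub> symmetry K (under A) (under A) = mul A"

text \<open>An object \<open>M\<close> with a left action \<open>A \<otimes> M \<rightarrow> M\<close> and a right action \<open>M \<otimes> A \<rightarrow> M\<close>.\<close>

record ('o, 'm) bimod_obj =
  bimod_under :: 'o
  left_act :: 'm
  right_act :: 'm

definition bimodule_hom ::
    "('o, 'm, 'z) tt_category_scheme \<Rightarrow> ('o, 'm) ring_obj \<Rightarrow> ('o, 'm) bimod_obj \<Rightarrow>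
      ('o, 'm) bimod_obj \<Rightarrow> 'm \<Rightarrow> bool" where
  "bimodule_hom K A M N s \<longleftrightarrow>
     s \<in> Hom K (bimod_under M) (bimod_under N) \<and>
     s \<cdot>\<^bsub>K\<^esub> left_act M = left_act N \<cdot>\<^bsub>K\<^esub> (idm\<^bsub>K\<^esub> (under A) \<otimes>\<^sub>m\<^bsub>K\<^esub> s) \<and>
     s \<cdot>\<^bsub>K\<^esub> right_act M = right_act N \<cdot>\<^bsub>K\<^esub> (s \<otimes>\<^sub>m\<^bsub>K\<^esub> idm\<^bsub>K\<^esub> (under A))"

definition regular_bimodule :: "('o, 'm) ring_obj \<Rightarrow> ('o, 'm) bimod_obj" where
  "regular_bimodule A = \<lparr>bimod_under = under A, left_act = mul A, right_act = mul A\<rparr>"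

text \<open>\<open>A \<otimes> A\<close>, with \<open>A\<close> acting from the left on the left factor and from the right on the right one.\<close>

definition tensor_bimodule ::
    "('o, 'm, 'z) tt_category_scheme \<Rightarrow> ('o, 'm) ring_obj \<Rightarrow> ('o, 'm) bimod_obj" where
  "tensor_bimodule K A =
     \<lparr>bimod_under = under A \<otimes>\<^sub>o\<^bsub>K\<^esub> under A,
      left_act = (mul A \<otimes>\<^sub>m\<^bsub>K\<^esub> idm\<^bsub>K\<^esub> (under A)) \<cdot>\<^bsub>K\<^esub>
        inv_mor K (associator K (under A) (under A) (under A)),
      right_act = (idm\<^bsub>K\<^esub> (under A) \<otimes>\<^sub>m\<^bsub>K\<^esub> mul A) \<cdot>\<^bsub>K\<^esub> associator K (under A) (under A) (under A)\<rparr>"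

definition separable :: "('o, 'm, 'z) tt_category_scheme \<Rightarrow> ('o, 'm) ring_obj \<Rightarrow> bool" where
  "separable K A \<longleftrightarrow>
     (\<exists>s. bimodule_hom K A (regular_bimodule A) (tensor_bimodule K A) s \<and>
        mul A \<cdot>\<^bsub>K\<^esub> s = idm\<^bsub>K\<^esub> (under A))"

definition tt_ring :: "('o, 'm, 'z) tt_category_scheme \<Rightarrow> ('o, 'm) ring_obj \<Rightarrow> bool" where
  "tt_ring K A \<longleftrightarrow> commutative_ring_object K A \<and> separable K A"

definition ring_obj_hom ::
    "('o, 'm, 'z) tt_category_scheme \<Rightarrow> ('o, 'm) ring_obj \<Rightarrow> ('o, 'm) ring_obj \<Rightarrow> 'm \<Rightarrow> bool" where
  "ring_obj_hom K A B f \<longleftrightarrow>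
     f \<in> Hom K (under A) (under B) \<and>
     f \<cdot>\<^bsub>K\<^esub> mul A = mul B \<cdot>\<^bsub>K\<^esub> (f \<otimes>\<^sub>m\<^bsub>K\<^esub> f) \<and>
     f \<cdot>\<^bsub>K\<^esub> unit A = unit B"

definition ring_obj_iso ::
    "('o, 'm, 'z) tt_category_scheme \<Rightarrow> ('o, 'm) ring_obj \<Rightarrow> ('o, 'm) ring_obj \<Rightarrow> 'm \<Rightarrow> bool" where
  "ring_obj_iso K A B f \<longleftrightarrow>
     ring_obj_hom K A B f \<and> (\<exists>k. ring_obj_hom K B A k \<and> inverse_mors K f k)"

definition ring_prod ::
    "('o, 'm, 'z) tt_category_scheme \<Rightarrow> ('o, 'm) ring_obj \<Rightarrow> ('o, 'm) ring_obj \<Rightarrow>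
      ('o, 'm) ring_obj" where
  "ring_prod K A C =
     (let p1 = dsum_pr1 K (under A) (under C); p2 = dsum_pr2 K (under A) (under C) in
      \<lparr>under = dsum K (under A) (under C),
       mul = dsum_pair K (mul A \<cdot>\<^bsub>K\<^esub> (p1 \<otimes>\<^sub>m\<^bsub>K\<^esub> p1)) (mul C \<cdot>\<^bsub>K\<^esub> (p2 \<otimes>\<^sub>m\<^bsub>K\<^esub> p2)),
       unit = dsum_pair K (unit A) (unit C)\<rparr>)"

abbreviation ring_pr1 ::
    "('o, 'm, 'z) tt_category_scheme \<Rightarrow> ('o, 'm) ring_obj \<Rightarrow> ('o, 'm) ring_obj \<Rightarrow> 'm" where
  "ring_pr1 K A C \<equiv> dsum_pr1 K (under A) (under C)"

abbreviation ring_pr2 ::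
    "('o, 'm, 'z) tt_category_scheme \<Rightarrow> ('o, 'm) ring_obj \<Rightarrow> ('o, 'm) ring_obj \<Rightarrow> 'm" where
  "ring_pr2 K A C \<equiv> dsum_pr2 K (under A) (under C)"

text \<open>
  An \<open>A\<close>-algebra is a tt-ring \<open>D\<close> together with its structure homomorphism \<open>d : A \<rightarrow> D\<close>.
\<close>

definition tt_algebra ::
    "('o, 'm, 'z) tt_category_scheme \<Rightarrow> ('o, 'm) ring_obj \<Rightarrow> ('o, 'm) ring_obj \<Rightarrow> 'm \<Rightarrow> bool" where
  "tt_algebra K A D d \<longleftrightarrow> tt_ring K D \<and> ring_obj_hom K A D d"

definition algebra_hom ::
    "('o, 'm, 'z) tt_category_scheme \<Rightarrow> ('o, 'm) ring_obj \<times> 'm \<Rightarrow> ('o, 'm) ring_obj \<times> 'm \<Rightarrow>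
      'm \<Rightarrow> bool" where
  "algebra_hom K = (\<lambda>(D, d) (E, e) k. ring_obj_hom K D E k \<and> k \<cdot>\<^bsub>K\<^esub> d = e)"

definition algebra_iso ::
    "('o, 'm, 'z) tt_category_scheme \<Rightarrow> ('o, 'm) ring_obj \<times> 'm \<Rightarrow> ('o, 'm) ring_obj \<times> 'm \<Rightarrow>
      'm \<Rightarrow> bool" where
  "algebra_iso K X Y k \<longleftrightarrow>
     algebra_hom K X Y k \<and> (\<exists>k'. algebra_hom K Y X k' \<and> inverse_mors K k k')"

definition prod_algebra ::
    "('o, 'm, 'z) tt_category_scheme \<Rightarrow> ('o, 'm) ring_obj \<Rightarrow> ('o, 'm) ring_obj \<times> 'm \<Rightarrow>
      ('o, 'm) ring_obj \<times> 'm" where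
  "prod_algebra K A = (\<lambda>(D, d). (ring_prod K A D, dsum_pair K (idm\<^bsub>K\<^esub> (under A)) d))"

end

theory Submission
  imports Defs
begin

text \<open>
  Write \<open>\<sigma>\<close> for the bimodule section of the multiplication of \<open>B\<close> and put
  \<open>t = \<mu> (1 \<otimes> f g) \<sigma> : B \<rightarrow> B\<close>, the average over the separability idempotent of the section \<open>f\<close> of
  \<open>g\<close>.  This is a \<open>B\<close>-linear idempotent with \<open>g t = g\<close> and \<open>t f g = t\<close>, so \<open>s = t f\<close> is a
  \<open>B\<close>-linear section of \<open>g\<close> with \<open>s g = t\<close>.  The ring \<open>C\<close> is the image of \<open>1 - t\<close>, that is, of
  multiplication by the idempotent element complementary to \<open>t(1)\<close>; it is split off by a ring homomorphism
  \<open>r : B \<rightarrow> C\<close> with a section \<open>i\<close> that is multiplicative but not unital, and \<open>h = (g, r)\<close>.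
  For a second splitting with \<open>r' : B \<rightarrow> C'\<close>, linearity of \<open>t\<close> forces \<open>r' s = 0\<close>, whence \<open>r'\<close>
  factors through \<open>r\<close> as \<open>l = r' i\<close>.
\<close>

section \<open>Typed composition, cancellation and inverses in a category\<close>

context category
begin

text \<open>
  Domains are tracked by \<open>src\<close> and \<open>tgt\<close> rather than by hom-sets, so that typing conditions
  contain no extra variables and the simplifier can discharge them.
\<close>

lemma HomD: "f \<in> Hom K a b \<Longrightarrow> f \<in> mor K \<and> src K f = a \<and> tgt K f = b"
  by (simp add: Hom_def)

lemma HomI: "f \<in> mor K \<Longrightarrow> src K f = a \<Longrightarrow> tgt K f = b \<Longrightarrow> f \<in> Hom K a b"
  by (simp add: Hom_def)

lemma mor_Hom: "f \<in> mor K \<Longrightarrow> f \<in> Hom K (src K f) (tgt K f)"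
  by (simp add: Hom_def)

declare src_ob [simp] tgt_ob [simp]

lemma ident_mor [simp]:
  assumes "a \<in> ob K"
  shows "idm a \<in> mor K" "src K (idm a) = a" "tgt K (idm a) = a"
  using HomD [OF ident_Hom [OF assms]] by auto

lemma compose_mor [simp]:
  assumes "f \<in> mor K" "g \<in> mor K" "tgt K f = src K g"
  shows "g \<cdot> f \<in> mor K" "src K (g \<cdot> f) = src K f" "tgt K (g \<cdot> f) = tgt K g"
  using HomD [OF compose_Hom [of f "src K f" "src K g" g "tgt K g"]] assms
  by (auto simp: Hom_def)

lemma compose_ident [simp]:
  "f \<in> mor K \<Longrightarrow> src K f = a \<Longrightarrow> f \<cdot> idm a = f"
  "f \<in> mor K \<Longrightarrow> tgt K f = b \<Longrightarrow> idm b \<cdot> f = f"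
  by (auto intro: compose_ident_right compose_ident_left simp: Hom_def)

text \<open>As a rewrite rule this nests every composite to the right. An equation between
  composites then no longer matches inside a longer one, so equations used for rewriting below often
  come with a second version, composed with a further morphism \<open>x\<close>.\<close>

lemma assoc [simp]:
  assumes "f \<in> mor K" "g \<in> mor K" "h \<in> mor K" "tgt K f = src K g" "tgt K g = src K h"
  shows "(h \<cdot> g) \<cdot> f = h \<cdot> (g \<cdot> f)"
  by (rule compose_assoc [of f "src K f" "src K g" g "src K h" h "tgt K h"])
    (use assms in \<open>auto simp: Hom_def\<close>)

text \<open>A split epimorphism is epic. Equations out of \<open>C\<close> are later tested after
  precomposition with tensor powers of \<open>r : B \<rightarrow> C\<close>, where they turn into
  equations known for \<open>B\<close>; unitors are cancelled in the same way.\<close>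

lemma compose_cancel_split_epi:
  assumes eq: "x \<cdot> r = y \<cdot> r" and ri: "r \<cdot> i = idm (tgt K r)"
    and "r \<in> mor K" "i \<in> mor K" "tgt K i = src K r"
    and "x \<in> mor K" "y \<in> mor K" "src K x = tgt K r" "src K y = tgt K r"
  shows "x = y"
proof -
  have "x = (x \<cdot> r) \<cdot> i" using assms(2-) by simp
  also have "\<dots> = (y \<cdot> r) \<cdot> i" by (simp only: eq)
  also have "\<dots> = y" using assms(2-) by simp
  finally show ?thesis .
qed

text \<open>Two-sided inverses are unique, so the definite description in \<open>inv_mor\<close>
  really picks one.\<close>

lemma inv_mor_inverse:
  assumes "isomorphism K f"
  shows "inverse_mors K f (inv_mor K f)"
proof -
  obtain g where g: "inverse_mors K f g"
    using assms by (auto simp: isomorphism_def)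
  have "g' = g" if g': "inverse_mors K f g'" for g'
  proof -
    have ty: "f \<in> mor K" "g \<in> mor K" "g' \<in> mor K" "src K g = tgt K f" "tgt K g = src K f"
      "src K g' = tgt K f" "tgt K g' = src K f"
      and eqs: "f \<cdot> g = idm (tgt K f)" "g' \<cdot> f = idm (src K f)"
      using g g' by (auto simp: inverse_mors_def dest!: HomD)
    have "g' = g' \<cdot> (f \<cdot> g)" using ty by (simp add: eqs)
    also have "\<dots> = (g' \<cdot> f) \<cdot> g" using ty by simp
    also have "\<dots> = g" using ty by (simp only: eqs) simp
    finally show ?thesis .
  qed
  with g show ?thesis
    unfolding inv_mor_def by (rule theI)
qed

end

section \<open>Groups of morphisms and the chosen biproducts\<close>

context additive_category
begin

lemma add_mor [simp]:
  assumes "f \<in> mor K" "g \<in> mor K" "src K f = src K g" "tgt K f = tgt K g"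
  shows "f \<boxplus> g \<in> mor K" "src K (f \<boxplus> g) = src K g" "tgt K (f \<boxplus> g) = tgt K g"
proof -
  interpret G: comm_group "Hom_group K (src K g) (tgt K g)"
    using assms by (intro Hom_comm_group) auto
  have "f \<boxplus> g \<in> Hom K (src K g) (tgt K g)"
    using G.m_closed [of f g] assms by (simp add: Hom_group_def Hom_def)
  then show "f \<boxplus> g \<in> mor K" "src K (f \<boxplus> g) = src K g" "tgt K (f \<boxplus> g) = tgt K g"
    by (auto simp: Hom_def)
qed

lemma zero_mor [simp]:
  assumes "a \<in> ob K" "b \<in> ob K"
  shows "zero_mor K a b \<in> mor K" "src K (zero_mor K a b) = a" "tgt K (zero_mor K a b) = b"
proof -
  interpret G: comm_group "Hom_group K a b"
    using assms by (intro Hom_comm_group) auto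
  show "zero_mor K a b \<in> mor K" "src K (zero_mor K a b) = a" "tgt K (zero_mor K a b) = b"
    using G.one_closed by (auto simp: Hom_group_def Hom_def)
qed

lemma add_zero [simp]:
  assumes "f \<in> mor K" "src K f = a" "tgt K f = b"
  shows "f \<boxplus> zero_mor K a b = f" "zero_mor K a b \<boxplus> f = f"
proof -
  interpret G: comm_group "Hom_group K a b"
    using assms by (intro Hom_comm_group) auto
  show "f \<boxplus> zero_mor K a b = f" "zero_mor K a b \<boxplus> f = f"
    using G.r_one [of f] G.l_one [of f] assms by (auto simp: Hom_group_def Hom_def)
qed

lemma add_cancel_left:
  assumes "f \<boxplus> x = f \<boxplus> y" "f \<in> mor K" "x \<in> mor K" "y \<in> mor K"
    "src K x = src K f" "src K y = src K f" "tgt K x = tgt K f" "tgt K y = tgt K f"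
  shows "x = y"
proof -
  interpret G: comm_group "Hom_group K (src K f) (tgt K f)"
    using assms by (intro Hom_comm_group) auto
  show ?thesis
    using assms G.Units_l_cancel [of f x y, unfolded G.Units_eq] by (auto simp: Hom_group_def Hom_def)
qed

text \<open>This supplies \<open>1 - t\<close> without a calculus of negatives: the complement is
  known only through its sum with \<open>f\<close>, and cancellation does the rest.\<close>

lemma ex_complement:
  assumes "f \<in> mor K" "h \<in> mor K" "src K f = src K h" "tgt K f = tgt K h"
  obtains x where "x \<in> mor K" "src K x = src K h" "tgt K x = tgt K h" "f \<boxplus> x = h"
proof -
  interpret G: comm_group "Hom_group K (src K h) (tgt K h)"
    using assms by (intro Hom_comm_group) auto
  let ?x = "monoid.mult (Hom_group K (src K h) (tgt K h)) (inv\<^bsub>Hom_group K (src K h) (tgt K h)\<^esub> f) h"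
  have c: "f \<in> carrier (Hom_group K (src K h) (tgt K h))" "h \<in> carrier (Hom_group K (src K h) (tgt K h))"
    using assms by (auto simp: Hom_group_def Hom_def)
  have "?x \<in> carrier (Hom_group K (src K h) (tgt K h))"
    using c by simp
  moreover have "monoid.mult (Hom_group K (src K h) (tgt K h)) f ?x = h"
    using c by (simp add: G.m_assoc [symmetric])
  ultimately show thesis
    by (intro that [of ?x]) (auto simp: Hom_group_def Hom_def)
qed

lemma compose_add [simp]:
  assumes "f \<in> mor K" "f' \<in> mor K" "src K f = src K f'" "tgt K f = tgt K f'" "g \<in> mor K"
  shows "tgt K f' = src K g \<Longrightarrow> g \<cdot> (f \<boxplus> f') = (g \<cdot> f) \<boxplus> (g \<cdot> f')"
    and "src K f' = tgt K g \<Longrightarrow> (f \<boxplus> f') \<cdot> g = (f \<cdot> g) \<boxplus> (f' \<cdot> g)"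
proof -
  show "g \<cdot> (f \<boxplus> f') = (g \<cdot> f) \<boxplus> (g \<cdot> f')" if "tgt K f' = src K g"
    by (rule compose_add_right [of f "src K f'" "tgt K f'" f' g "tgt K g"])
      (use assms that in \<open>auto simp: Hom_def\<close>)
  show "(f \<boxplus> f') \<cdot> g = (f \<cdot> g) \<boxplus> (f' \<cdot> g)" if "src K f' = tgt K g"
    by (rule compose_add_left [of g "src K g" "src K f'" f "tgt K f'" f'])
      (use assms that in \<open>auto simp: Hom_def\<close>)
qed

text \<open>Cancellation in \<open>F(0) = F(0) + F(0)\<close>. Additivity is assumed at the pair
  \<open>(0, 0)\<close> alone, so the same lemma serves composition on either side and
  tensoring.\<close>

lemma additive_map_zero:
  assumes add: "F (zero_mor K a b \<boxplus> zero_mor K a b) = F (zero_mor K a b) \<boxplus> F (zero_mor K a b)"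
    and "a \<in> ob K" "b \<in> ob K"
    and "F (zero_mor K a b) \<in> Hom K c d"
  shows "F (zero_mor K a b) = zero_mor K c d"
proof -
  have ty: "F (zero_mor K a b) \<in> mor K" "src K (F (zero_mor K a b)) = c" "tgt K (F (zero_mor K a b)) = d"
    using assms by (auto simp: Hom_def)
  have ob: "c \<in> ob K" "d \<in> ob K"
    using ty src_ob tgt_ob by blast+
  show ?thesis
    by (rule add_cancel_left [of "F (zero_mor K a b)"])
      (use assms(2,3) add ty ob in auto)
qed

lemma compose_zero [simp]:
  assumes "f \<in> mor K"
  shows "src K f = b \<Longrightarrow> a \<in> ob K \<Longrightarrow> f \<cdot> zero_mor K a b = zero_mor K a (tgt K f)"
    and "tgt K f = a \<Longrightarrow> b \<in> ob K \<Longrightarrow> zero_mor K a b \<cdot> f = zero_mor K (src K f) b"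
proof -
  show "f \<cdot> zero_mor K a b = zero_mor K a (tgt K f)" if "src K f = b" "a \<in> ob K"
    by (rule additive_map_zero, rule compose_add) (use that assms in \<open>auto intro!: HomI\<close>)
  show "zero_mor K a b \<cdot> f = zero_mor K (src K f) b" if "tgt K f = a" "b \<in> ob K"
    by (rule additive_map_zero [where F = "\<lambda>x. x \<cdot> f"], rule compose_add)
      (use that assms in \<open>auto intro!: HomI\<close>)
qed

lemma dsum_biproduct:
  assumes "a \<in> ob K" "b \<in> ob K"
  shows "is_biproduct K a b
    (dsum K a b, dsum_in1 K a b, dsum_in2 K a b, dsum_pr1 K a b, dsum_pr2 K a b)"
proof -
  have "is_biproduct K a b (dsum_data K a b)"
    unfolding dsum_data_def using ex_biproduct [OF assms] by (rule someI_ex)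
  then show ?thesis
    by (auto simp: dsum_def dsum_in1_def dsum_in2_def dsum_pr1_def dsum_pr2_def split: prod.splits)
qed

lemma dsum_simps [simp]:
  assumes "a \<in> ob K" "b \<in> ob K"
  shows "dsum K a b \<in> ob K"
    and "dsum_in1 K a b \<in> mor K" "src K (dsum_in1 K a b) = a" "tgt K (dsum_in1 K a b) = dsum K a b"
    and "dsum_in2 K a b \<in> mor K" "src K (dsum_in2 K a b) = b" "tgt K (dsum_in2 K a b) = dsum K a b"
    and "dsum_pr1 K a b \<in> mor K" "src K (dsum_pr1 K a b) = dsum K a b" "tgt K (dsum_pr1 K a b) = a"
    and "dsum_pr2 K a b \<in> mor K" "src K (dsum_pr2 K a b) = dsum K a b" "tgt K (dsum_pr2 K a b) = b"
    and "dsum_pr1 K a b \<cdot> dsum_in1 K a b = idm a" "dsum_pr2 K a b \<cdot> dsum_in2 K a b = idm b"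
    and "dsum_pr2 K a b \<cdot> dsum_in1 K a b = zero_mor K a b"
    and "dsum_pr1 K a b \<cdot> dsum_in2 K a b = zero_mor K b a"
    and "(dsum_in1 K a b \<cdot> dsum_pr1 K a b) \<boxplus> (dsum_in2 K a b \<cdot> dsum_pr2 K a b) = idm (dsum K a b)"
  using dsum_biproduct [OF assms] by (auto simp: is_biproduct_def dest!: HomD)

lemma dsum_simps_comp [simp]:
  assumes "a \<in> ob K" "b \<in> ob K" "x \<in> mor K"
  shows "tgt K x = a \<Longrightarrow> dsum_pr1 K a b \<cdot> dsum_in1 K a b \<cdot> x = x"
    and "tgt K x = b \<Longrightarrow> dsum_pr2 K a b \<cdot> dsum_in2 K a b \<cdot> x = x"
    and "tgt K x = a \<Longrightarrow> dsum_pr2 K a b \<cdot> dsum_in1 K a b \<cdot> x = zero_mor K (src K x) b"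
    and "tgt K x = b \<Longrightarrow> dsum_pr1 K a b \<cdot> dsum_in2 K a b \<cdot> x = zero_mor K (src K x) a"
  using assms by (simp_all del: assoc add: assoc [symmetric])

text \<open>The two projections are jointly monic, because the identity of the sum is
  \<open>in1 pr1 + in2 pr2\<close>.\<close>

lemma dsum_eqI:
  assumes "a \<in> ob K" "b \<in> ob K" "x \<in> mor K" "y \<in> mor K" "tgt K x = dsum K a b" "tgt K y = dsum K a b"
    and 1: "dsum_pr1 K a b \<cdot> x = dsum_pr1 K a b \<cdot> y"
    and 2: "dsum_pr2 K a b \<cdot> x = dsum_pr2 K a b \<cdot> y"
  shows "x = y"
proof -
  have decomp: "z = (dsum_in1 K a b \<cdot> dsum_pr1 K a b \<cdot> z) \<boxplus> (dsum_in2 K a b \<cdot> dsum_pr2 K a b \<cdot> z)"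
    if "z \<in> mor K" "tgt K z = dsum K a b" for z
  proof -
    \<comment> \<open>Distributivity is switched off here, and the collapse of the sum to the
      identity is switched off in the next step, so that neither rule disturbs the other.\<close>
    have "z = ((dsum_in1 K a b \<cdot> dsum_pr1 K a b) \<boxplus> (dsum_in2 K a b \<cdot> dsum_pr2 K a b)) \<cdot> z"
      using that assms by (simp del: compose_add)
    also have "\<dots> = (dsum_in1 K a b \<cdot> dsum_pr1 K a b \<cdot> z) \<boxplus> (dsum_in2 K a b \<cdot> dsum_pr2 K a b \<cdot> z)"
      using that assms by (simp del: dsum_simps(18))
    finally show ?thesis .
  qed
  show ?thesis
    using decomp [of x] decomp [of y] 1 2 assms by simp
qed

lemma dsum_pair_simps [simp]:
  assumes "u \<in> mor K" "v \<in> mor K" "src K u = src K v"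
  shows "dsum_pair K u v \<in> mor K" "src K (dsum_pair K u v) = src K v"
    and "tgt K (dsum_pair K u v) = dsum K (tgt K u) (tgt K v)"
    and "tgt K u = a \<Longrightarrow> tgt K v = b \<Longrightarrow> dsum_pr1 K a b \<cdot> dsum_pair K u v = u"
    and "tgt K u = a \<Longrightarrow> tgt K v = b \<Longrightarrow> dsum_pr2 K a b \<cdot> dsum_pair K u v = v"
  using assms by (auto simp: dsum_pair_def)

lemma dsum_pr_pair_comp [simp]:
  assumes "u \<in> mor K" "v \<in> mor K" "src K u = src K v" "tgt K u = a" "tgt K v = b"
    and "x \<in> mor K" "tgt K x = src K v"
  shows "dsum_pr1 K a b \<cdot> dsum_pair K u v \<cdot> x = u \<cdot> x"
    and "dsum_pr2 K a b \<cdot> dsum_pair K u v \<cdot> x = v \<cdot> x"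
  using assms by (auto simp del: assoc simp add: assoc [symmetric])

end

section \<open>Tensor calculus, ring objects and their homomorphisms\<close>

context symmetric_monoidal_category
begin

declare unit_ob [simp] tensor_ob [simp] tensor_ident [simp]

lemma tensor_mor [simp]:
  assumes "f \<in> mor K" "g \<in> mor K"
  shows "f \<otimes>\<^sub>m g \<in> mor K" "src K (f \<otimes>\<^sub>m g) = src K f \<otimes>\<^sub>o src K g"
    "tgt K (f \<otimes>\<^sub>m g) = tgt K f \<otimes>\<^sub>o tgt K g"
  using HomD [OF tensor_mor_Hom [OF mor_Hom mor_Hom]] assms by auto

lemma interchange [simp]:
  assumes "f \<in> mor K" "f' \<in> mor K" "g \<in> mor K" "g' \<in> mor K" "tgt K f = src K f'" "tgt K g = src K g'"
  shows "(f' \<otimes>\<^sub>m g') \<cdot> (f \<otimes>\<^sub>m g) = (f' \<cdot> f) \<otimes>\<^sub>m (g' \<cdot> g)"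
  by (rule tensor_compose [symmetric, of f "src K f" "src K f'" f' "tgt K f'" g "src K g" "src K g'" g' "tgt K g'"])
    (use assms in \<open>auto simp: Hom_def\<close>)

lemma interchange_comp [simp]:
  assumes "f \<in> mor K" "f' \<in> mor K" "g \<in> mor K" "g' \<in> mor K" "tgt K f = src K f'" "tgt K g = src K g'"
    and "x \<in> mor K" "tgt K x = src K f \<otimes>\<^sub>o src K g"
  shows "(f' \<otimes>\<^sub>m g') \<cdot> (f \<otimes>\<^sub>m g) \<cdot> x = ((f' \<cdot> f) \<otimes>\<^sub>m (g' \<cdot> g)) \<cdot> x"
  using assms by (simp_all del: assoc add: assoc [symmetric])

lemma associator_mor [simp]:
  assumes "a \<in> ob K" "b \<in> ob K" "c \<in> ob K"
  shows "associator K a b c \<in> mor K" "src K (associator K a b c) = (a \<otimes>\<^sub>o b) \<otimes>\<^sub>o c"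
    "tgt K (associator K a b c) = a \<otimes>\<^sub>o (b \<otimes>\<^sub>o c)"
  using HomD [OF associator_Hom] assms by auto

lemma unitor_mor [simp]:
  assumes "a \<in> ob K"
  shows "lunitor K a \<in> mor K" "src K (lunitor K a) = unit_ob K \<otimes>\<^sub>o a" "tgt K (lunitor K a) = a"
    "runitor K a \<in> mor K" "src K (runitor K a) = a \<otimes>\<^sub>o unit_ob K" "tgt K (runitor K a) = a"
  using HomD [OF lunitor_Hom] HomD [OF runitor_Hom] assms by auto

lemma symmetry_mor [simp]:
  assumes "a \<in> ob K" "b \<in> ob K"
  shows "symmetry K a b \<in> mor K" "src K (symmetry K a b) = a \<otimes>\<^sub>o b" "tgt K (symmetry K a b) = b \<otimes>\<^sub>o a"
  using HomD [OF symmetry_Hom] assms by auto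

lemma inv_associator [simp]:
  assumes "a \<in> ob K" "b \<in> ob K" "c \<in> ob K"
  shows "inv_mor K (associator K a b c) \<in> mor K"
    "src K (inv_mor K (associator K a b c)) = a \<otimes>\<^sub>o (b \<otimes>\<^sub>o c)"
    "tgt K (inv_mor K (associator K a b c)) = (a \<otimes>\<^sub>o b) \<otimes>\<^sub>o c"
    "associator K a b c \<cdot> inv_mor K (associator K a b c) = idm (a \<otimes>\<^sub>o (b \<otimes>\<^sub>o c))"
    "inv_mor K (associator K a b c) \<cdot> associator K a b c = idm ((a \<otimes>\<^sub>o b) \<otimes>\<^sub>o c)"
  using inv_mor_inverse [OF associator_iso [OF assms]] assms
  by (auto simp: inverse_mors_def dest!: HomD)

lemma inv_associator_comp [simp]:
  assumes "a \<in> ob K" "b \<in> ob K" "c \<in> ob K" "x \<in> mor K"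
  shows "tgt K x = a \<otimes>\<^sub>o (b \<otimes>\<^sub>o c) \<Longrightarrow>
      associator K a b c \<cdot> inv_mor K (associator K a b c) \<cdot> x = x"
    and "tgt K x = (a \<otimes>\<^sub>o b) \<otimes>\<^sub>o c \<Longrightarrow>
      inv_mor K (associator K a b c) \<cdot> associator K a b c \<cdot> x = x"
  using assms by (simp_all del: assoc add: assoc [symmetric])

text \<open>Oriented so that the associator moves to the left. The indices are variables tied to the
  sources by equations, so that \<open>subst\<close> matches whatever form these objects have in the
  goal.\<close>

lemma associator_nat:
  assumes "f \<in> mor K" "g \<in> mor K" "h \<in> mor K"
    and "a = src K f" "b = src K g" "c = src K h"
  shows "(f \<otimes>\<^sub>m (g \<otimes>\<^sub>m h)) \<cdot> associator K a b c =
    associator K (tgt K f) (tgt K g) (tgt K h) \<cdot> ((f \<otimes>\<^sub>m g) \<otimes>\<^sub>m h)"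
  using associator_natural [OF mor_Hom mor_Hom mor_Hom] assms by auto

lemma inv_associator_nat:
  assumes "f \<in> mor K" "g \<in> mor K" "h \<in> mor K"
    and "a = src K f" "b = src K g" "c = src K h"
  shows "((f \<otimes>\<^sub>m g) \<otimes>\<^sub>m h) \<cdot> inv_mor K (associator K a b c) =
    inv_mor K (associator K (tgt K f) (tgt K g) (tgt K h)) \<cdot> (f \<otimes>\<^sub>m (g \<otimes>\<^sub>m h))"
proof -
  let ?a = "associator K a b c" and ?b = "associator K (tgt K f) (tgt K g) (tgt K h)"
  have "((f \<otimes>\<^sub>m g) \<otimes>\<^sub>m h) \<cdot> inv_mor K ?a = (inv_mor K ?b \<cdot> ?b) \<cdot> ((f \<otimes>\<^sub>m g) \<otimes>\<^sub>m h) \<cdot> inv_mor K ?a"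
    using assms by (simp del: assoc)
  also have "\<dots> = inv_mor K ?b \<cdot> (?b \<cdot> ((f \<otimes>\<^sub>m g) \<otimes>\<^sub>m h)) \<cdot> inv_mor K ?a"
    using assms by simp
  also have "?b \<cdot> ((f \<otimes>\<^sub>m g) \<otimes>\<^sub>m h) = (f \<otimes>\<^sub>m (g \<otimes>\<^sub>m h)) \<cdot> ?a"
    using associator_nat [of f g h a b c] assms by simp
  finally show ?thesis using assms by simp
qed

lemma ring_object_mor:
  assumes "ring_object K R"
  shows "under R \<in> ob K"
    and "mul R \<in> mor K" "src K (mul R) = under R \<otimes>\<^sub>o under R" "tgt K (mul R) = under R"
    and "unit R \<in> mor K" "src K (unit R) = unit_ob K" "tgt K (unit R) = under R"
  using assms by (auto simp: ring_object_def dest!: HomD)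

lemma ring_object_laws:
  assumes "ring_object K R"
  shows "mul R \<cdot> (mul R \<otimes>\<^sub>m idm (under R)) =
      mul R \<cdot> (idm (under R) \<otimes>\<^sub>m mul R) \<cdot> associator K (under R) (under R) (under R)"
    and "mul R \<cdot> (unit R \<otimes>\<^sub>m idm (under R)) = lunitor K (under R)"
    and "mul R \<cdot> (idm (under R) \<otimes>\<^sub>m unit R) = runitor K (under R)"
  using assms by (auto simp: ring_object_def)

lemma ring_obj_homD:
  assumes "ring_obj_hom K R S r"
  shows "r \<in> mor K" "src K r = under R" "tgt K r = under S"
    and "r \<cdot> mul R = mul S \<cdot> (r \<otimes>\<^sub>m r)" "r \<cdot> unit R = unit S"
  using assms by (auto simp: ring_obj_hom_def dest!: HomD)

lemma ring_obj_hom_comp: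
  assumes R: "ring_object K R" and S: "ring_object K S" and T: "ring_object K T"
    and r: "ring_obj_hom K R S r" and q: "ring_obj_hom K S T q"
  shows "ring_obj_hom K R T (q \<cdot> r)"
proof -
  note ty [simp] = ring_object_mor [OF R] ring_object_mor [OF S] ring_object_mor [OF T]
    ring_obj_homD(1-3) [OF r] ring_obj_homD(1-3) [OF q]
  have "(q \<cdot> r) \<cdot> mul R = q \<cdot> mul S \<cdot> (r \<otimes>\<^sub>m r)"
    by (simp add: ring_obj_homD(4) [OF r])
  also have "\<dots> = (q \<cdot> mul S) \<cdot> (r \<otimes>\<^sub>m r)"
    by simp
  also have "\<dots> = mul T \<cdot> ((q \<cdot> r) \<otimes>\<^sub>m (q \<cdot> r))"
    by (simp only: ring_obj_homD(4) [OF q]) simp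
  finally show ?thesis
    using ring_obj_homD(5) [OF r] ring_obj_homD(5) [OF q]
    by (simp add: ring_obj_hom_def Hom_def)
qed

text \<open>Precompose the multiplication of \<open>S\<close> with
  \<open>(r q) \<otimes> (r q) = 1\<close>, move \<open>r\<close> through it and cancel
  \<open>q r = 1\<close>. The operations of \<open>R\<close> and \<open>S\<close> enter through
  their typings, which suits products of ring objects, where these typings are at hand.\<close>

lemma ring_obj_hom_inverse:
  assumes r: "ring_obj_hom K R S r" and inv: "inverse_mors K r q"
    and ty: "mul R \<in> mor K" "src K (mul R) = under R \<otimes>\<^sub>o under R" "tgt K (mul R) = under R"
      "unit R \<in> mor K" "tgt K (unit R) = under R"
      "mul S \<in> mor K" "src K (mul S) = under S \<otimes>\<^sub>o under S" "tgt K (mul S) = under S"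
  shows "ring_obj_hom K S R q"
proof -
  note [simp] = ring_obj_homD(1-3) [OF r] ty
  have q [simp]: "q \<in> mor K" "src K q = under S" "tgt K q = under R"
    "q \<cdot> r = idm (under R)" "r \<cdot> q = idm (under S)"
    using inv by (auto simp: inverse_mors_def dest!: HomD)
  have ob [simp]: "under R \<in> ob K" "under S \<in> ob K"
    using src_ob [of r] tgt_ob [of r] by auto
  have 1: "q \<cdot> r \<cdot> x = x" if "x \<in> mor K" "tgt K x = under R" for x
    using that by (simp del: assoc add: assoc [symmetric])
  have "q \<cdot> mul S = q \<cdot> (mul S \<cdot> (r \<otimes>\<^sub>m r)) \<cdot> (q \<otimes>\<^sub>m q)"
    by simp
  also have "\<dots> = q \<cdot> (r \<cdot> mul R) \<cdot> (q \<otimes>\<^sub>m q)"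
    by (simp only: ring_obj_homD(4) [OF r])
  also have "\<dots> = mul R \<cdot> (q \<otimes>\<^sub>m q)"
    by (simp add: 1)
  finally have m: "q \<cdot> mul S = mul R \<cdot> (q \<otimes>\<^sub>m q)" .
  have "q \<cdot> unit S = unit R"
    using 1 [of "unit R"] ring_obj_homD(5) [OF r] by simp
  with m show ?thesis
    by (simp add: ring_obj_hom_def Hom_def)
qed

end

section \<open>Ring structure on a split quotient of a ring object\<close>

locale split_ring_quotient = symmetric_monoidal_category K
  for K :: "('o, 'm, 'z) tt_category_scheme" (structure) +
  fixes B C :: "('o, 'm) ring_obj" and r i
  assumes B: "ring_object K B"
    and C: "under C \<in> ob K" "mul C \<in> Hom K (under C \<otimes>\<^sub>o under C) (under C)"
      "unit C \<in> Hom K (unit_ob K) (under C)"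
    and r: "ring_obj_hom K B C r"
    and i: "i \<in> Hom K (under C) (under B)" and ri: "r \<cdot> i = idm (under C)"
begin

lemma mors [simp]:
  "under C \<in> ob K" "mul C \<in> mor K" "src K (mul C) = under C \<otimes>\<^sub>o under C" "tgt K (mul C) = under C"
  "unit C \<in> mor K" "src K (unit C) = unit_ob K" "tgt K (unit C) = under C"
  "i \<in> mor K" "src K i = under C" "tgt K i = under B" "r \<cdot> i = idm (under C)"
  using C i ri by (auto dest!: HomD)

lemmas [simp] = ring_object_mor [OF B] ring_obj_homD(1-3) [OF r]

lemma r_i_comp [simp]: "x \<in> mor K \<Longrightarrow> tgt K x = under C \<Longrightarrow> r \<cdot> i \<cdot> x = x"
  by (simp del: assoc add: assoc [symmetric])

text \<open>Of the operations of \<open>C\<close> only the typing is given; each axiom descends from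
  \<open>B\<close>. Precomposed with a tensor product of copies of \<open>r\<close> and identities,
  both sides become \<open>r\<close> after the two sides of the corresponding law of
  \<open>B\<close>, and this tensor product is split by the analogous one formed with
  \<open>i\<close>.\<close>

lemma ring_object: "ring_object K C"
proof -
  let ?B = "under B" and ?C = "under C"
  have rm: "mul C \<cdot> (r \<otimes>\<^sub>m r) = r \<cdot> mul B"
    using ring_obj_homD(4) [OF r] by simp
  have ru: "unit C = r \<cdot> unit B"
    using ring_obj_homD(5) [OF r] by simp
  have assoc_C: "mul C \<cdot> (mul C \<otimes>\<^sub>m idm ?C) = mul C \<cdot> (idm ?C \<otimes>\<^sub>m mul C) \<cdot> associator K ?C ?C ?C"
  proof (rule compose_cancel_split_epi [of _ "(r \<otimes>\<^sub>m r) \<otimes>\<^sub>m r" _ "(i \<otimes>\<^sub>m i) \<otimes>\<^sub>m i"])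
    have "(mul C \<cdot> (mul C \<otimes>\<^sub>m idm ?C)) \<cdot> ((r \<otimes>\<^sub>m r) \<otimes>\<^sub>m r) = mul C \<cdot> ((mul C \<cdot> (r \<otimes>\<^sub>m r)) \<otimes>\<^sub>m r)"
      by simp
    also have "\<dots> = mul C \<cdot> ((r \<cdot> mul B) \<otimes>\<^sub>m r)"
      by (simp only: rm)
    also have "\<dots> = (mul C \<cdot> (r \<otimes>\<^sub>m r)) \<cdot> (mul B \<otimes>\<^sub>m idm ?B)"
      by simp
    also have "\<dots> = r \<cdot> mul B \<cdot> (mul B \<otimes>\<^sub>m idm ?B)"
      by (simp only: rm) simp
    also have "\<dots> = (r \<cdot> mul B) \<cdot> (idm ?B \<otimes>\<^sub>m mul B) \<cdot> associator K ?B ?B ?B"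
      by (simp add: ring_object_laws(1) [OF B])
    also have "\<dots> = (mul C \<cdot> (r \<otimes>\<^sub>m r)) \<cdot> (idm ?B \<otimes>\<^sub>m mul B) \<cdot> associator K ?B ?B ?B"
      by (simp only: rm)
    also have "\<dots> = mul C \<cdot> (r \<otimes>\<^sub>m (r \<cdot> mul B)) \<cdot> associator K ?B ?B ?B"
      by simp
    also have "\<dots> = mul C \<cdot> (idm ?C \<otimes>\<^sub>m mul C) \<cdot> (r \<otimes>\<^sub>m (r \<otimes>\<^sub>m r)) \<cdot> associator K ?B ?B ?B"
      by (simp add: rm)
    also have "\<dots> = (mul C \<cdot> (idm ?C \<otimes>\<^sub>m mul C) \<cdot> associator K ?C ?C ?C) \<cdot> ((r \<otimes>\<^sub>m r) \<otimes>\<^sub>m r)"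
      by (subst associator_nat) simp_all
    finally show "(mul C \<cdot> (mul C \<otimes>\<^sub>m idm ?C)) \<cdot> ((r \<otimes>\<^sub>m r) \<otimes>\<^sub>m r) =
        (mul C \<cdot> (idm ?C \<otimes>\<^sub>m mul C) \<cdot> associator K ?C ?C ?C) \<cdot> ((r \<otimes>\<^sub>m r) \<otimes>\<^sub>m r)" .
  qed simp_all
  have lunit_C: "mul C \<cdot> (unit C \<otimes>\<^sub>m idm ?C) = lunitor K ?C"
  proof (rule compose_cancel_split_epi [of _ "idm (unit_ob K) \<otimes>\<^sub>m r" _ "idm (unit_ob K) \<otimes>\<^sub>m i"])
    have "(mul C \<cdot> (unit C \<otimes>\<^sub>m idm ?C)) \<cdot> (idm (unit_ob K) \<otimes>\<^sub>m r) =
        (mul C \<cdot> (r \<otimes>\<^sub>m r)) \<cdot> (unit B \<otimes>\<^sub>m idm ?B)"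
      by (simp add: ru)
    also have "\<dots> = r \<cdot> lunitor K ?B"
      by (simp only: rm) (simp add: ring_object_laws(2) [OF B])
    also have "\<dots> = lunitor K ?C \<cdot> (idm (unit_ob K) \<otimes>\<^sub>m r)"
      using lunitor_natural [OF mor_Hom [of r]] by simp
    finally show "(mul C \<cdot> (unit C \<otimes>\<^sub>m idm ?C)) \<cdot> (idm (unit_ob K) \<otimes>\<^sub>m r) =
        lunitor K ?C \<cdot> (idm (unit_ob K) \<otimes>\<^sub>m r)" .
  qed simp_all
  have runit_C: "mul C \<cdot> (idm ?C \<otimes>\<^sub>m unit C) = runitor K ?C"
  proof (rule compose_cancel_split_epi [of _ "r \<otimes>\<^sub>m idm (unit_ob K)" _ "i \<otimes>\<^sub>m idm (unit_ob K)"])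
    have "(mul C \<cdot> (idm ?C \<otimes>\<^sub>m unit C)) \<cdot> (r \<otimes>\<^sub>m idm (unit_ob K)) =
        (mul C \<cdot> (r \<otimes>\<^sub>m r)) \<cdot> (idm ?B \<otimes>\<^sub>m unit B)"
      by (simp add: ru)
    also have "\<dots> = r \<cdot> runitor K ?B"
      by (simp only: rm) (simp add: ring_object_laws(3) [OF B])
    also have "\<dots> = runitor K ?C \<cdot> (r \<otimes>\<^sub>m idm (unit_ob K))"
      using runitor_natural [OF mor_Hom [of r]] by simp
    finally show "(mul C \<cdot> (idm ?C \<otimes>\<^sub>m unit C)) \<cdot> (r \<otimes>\<^sub>m idm (unit_ob K)) =
        runitor K ?C \<cdot> (r \<otimes>\<^sub>m idm (unit_ob K))" .
  qed simp_all
  show ?thesis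
    unfolding ring_object_def using C assoc_C lunit_C runit_C by blast
qed

lemma commutative_ring_object:
  assumes "commutative_ring_object K B"
  shows "commutative_ring_object K C"
proof -
  have rm: "mul C \<cdot> (r \<otimes>\<^sub>m r) = r \<cdot> mul B"
    using ring_obj_homD(4) [OF r] by simp
  have nat: "symmetry K (under C) (under C) \<cdot> (r \<otimes>\<^sub>m r) = (r \<otimes>\<^sub>m r) \<cdot> symmetry K (under B) (under B)"
    using symmetry_natural [OF mor_Hom [of r] mor_Hom [of r]] by simp
  have "mul C \<cdot> symmetry K (under C) (under C) = mul C"
  proof (rule compose_cancel_split_epi [of _ "r \<otimes>\<^sub>m r" _ "i \<otimes>\<^sub>m i"])
    have "(mul C \<cdot> symmetry K (under C) (under C)) \<cdot> (r \<otimes>\<^sub>m r) =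
        (mul C \<cdot> (r \<otimes>\<^sub>m r)) \<cdot> symmetry K (under B) (under B)"
      by (simp add: nat)
    also have "\<dots> = mul C \<cdot> (r \<otimes>\<^sub>m r)"
      by (simp only: rm) (use assms in \<open>simp add: commutative_ring_object_def\<close>)
    finally show "(mul C \<cdot> symmetry K (under C) (under C)) \<cdot> (r \<otimes>\<^sub>m r) = mul C \<cdot> (r \<otimes>\<^sub>m r)" .
  qed simp_all
  with ring_object show ?thesis
    by (simp add: commutative_ring_object_def)
qed

text \<open>Compressing the section for \<open>B\<close> along \<open>i\<close> and \<open>r\<close>
  gives a section for \<open>C\<close>. Linearity rests on the multiplicativity of \<open>i\<close>
  and of \<open>r\<close>; \<open>i\<close> may fail to preserve the unit, as for the inclusion of
  an ideal generated by an idempotent.\<close>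

lemma separable:
  assumes i_mul: "i \<cdot> mul C = mul B \<cdot> (i \<otimes>\<^sub>m i)" and "separable K B"
  shows "separable K C"
proof -
  let ?B = "under B" and ?C = "under C"
  let ?a = "associator K ?B ?B ?B" and ?c = "associator K ?C ?C ?C"
  obtain s where s: "bimodule_hom K B (regular_bimodule B) (tensor_bimodule K B) s"
    and ms: "mul B \<cdot> s = idm ?B"
    using assms by (auto simp: separable_def)
  have s_mor [simp]: "s \<in> mor K" "src K s = ?B" "tgt K s = ?B \<otimes>\<^sub>o ?B"
    and sl: "s \<cdot> mul B = (mul B \<otimes>\<^sub>m idm ?B) \<cdot> inv_mor K ?a \<cdot> (idm ?B \<otimes>\<^sub>m s)"
    and sr: "s \<cdot> mul B = (idm ?B \<otimes>\<^sub>m mul B) \<cdot> ?a \<cdot> (s \<otimes>\<^sub>m idm ?B)"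
    using s by (auto simp: bimodule_hom_def regular_bimodule_def tensor_bimodule_def dest!: HomD)
  have rm: "mul C \<cdot> (r \<otimes>\<^sub>m r) = r \<cdot> mul B"
    using ring_obj_homD(4) [OF r] by simp
  let ?s = "(r \<otimes>\<^sub>m r) \<cdot> s \<cdot> i"
  \<comment> \<open>The factor \<open>s \<cdot> mul B\<close> is isolated because it can be expanded
    by left or by right linearity of \<open>s\<close>.\<close>
  have expand: "?s \<cdot> mul C = (r \<otimes>\<^sub>m r) \<cdot> (s \<cdot> mul B) \<cdot> (i \<otimes>\<^sub>m i)"
    by (simp add: i_mul)
  have "?s \<cdot> mul C = ((r \<cdot> mul B) \<otimes>\<^sub>m r) \<cdot> inv_mor K ?a \<cdot> (i \<otimes>\<^sub>m (s \<cdot> i))"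
    unfolding expand sl by simp
  also have "\<dots> = (mul C \<otimes>\<^sub>m idm ?C) \<cdot> (((r \<otimes>\<^sub>m r) \<otimes>\<^sub>m r) \<cdot> inv_mor K ?a) \<cdot> (i \<otimes>\<^sub>m (s \<cdot> i))"
    by (simp add: rm)
  also have "\<dots> = (mul C \<otimes>\<^sub>m idm ?C) \<cdot> inv_mor K ?c \<cdot> (idm ?C \<otimes>\<^sub>m ?s)"
    by (subst inv_associator_nat) simp_all
  finally have l: "?s \<cdot> mul C = \<dots>" .
  have "?s \<cdot> mul C = (r \<otimes>\<^sub>m (r \<cdot> mul B)) \<cdot> ?a \<cdot> ((s \<cdot> i) \<otimes>\<^sub>m i)"
    unfolding expand sr by simp
  also have "\<dots> = (idm ?C \<otimes>\<^sub>m mul C) \<cdot> ((r \<otimes>\<^sub>m (r \<otimes>\<^sub>m r)) \<cdot> ?a) \<cdot> ((s \<cdot> i) \<otimes>\<^sub>m i)"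
    by (simp add: rm)
  also have "\<dots> = (idm ?C \<otimes>\<^sub>m mul C) \<cdot> ?c \<cdot> (?s \<otimes>\<^sub>m idm ?C)"
    by (subst associator_nat) simp_all
  finally have r: "?s \<cdot> mul C = \<dots>" .
  have "mul C \<cdot> ?s = (mul C \<cdot> (r \<otimes>\<^sub>m r)) \<cdot> s \<cdot> i"
    by simp
  also have "\<dots> = r \<cdot> (mul B \<cdot> s) \<cdot> i"
    by (simp only: rm) simp
  also have "\<dots> = idm ?C"
    by (simp only: ms) simp
  finally have "mul C \<cdot> ?s = idm ?C" .
  with l r show ?thesis
    unfolding separable_def bimodule_hom_def regular_bimodule_def tensor_bimodule_def
    by (intro exI [of _ ?s]) (simp add: Hom_def)
qed

end

section \<open>Additivity of the tensor product, and products of ring objects\<close>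

context tt_category
begin

lemma tensor_add_right:
  assumes "a \<in> ob K" "x \<in> mor K" "y \<in> mor K" "src K x = src K y" "tgt K x = tgt K y"
  shows "idm a \<otimes>\<^sub>m (x \<boxplus> y) = (idm a \<otimes>\<^sub>m x) \<boxplus> (idm a \<otimes>\<^sub>m y)"
proof -
  have "\<forall>b \<in> ob K. \<forall>c \<in> ob K. \<forall>f \<in> Hom K b c. \<forall>g \<in> Hom K b c.
      idm a \<otimes>\<^sub>m (f \<boxplus> g) = (idm a \<otimes>\<^sub>m f) \<boxplus> (idm a \<otimes>\<^sub>m g)"
    using tensor_exact_right [OF assms(1)]
    by (simp add: exact_endofunctor_def additive_endofunctor_def)
  then show ?thesis
    by (metis assms(2-) mor_Hom src_ob tgt_ob)
qed

text \<open>Factor the morphism as \<open>(0 \<otimes> 1) (1 \<otimes> x)\<close>; the first factor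
  vanishes because tensoring with a fixed object, being exact, is additive.\<close>

lemma tensor_zero_left:
  assumes "a \<in> ob K" "b \<in> ob K" "x \<in> mor K"
  shows "zero_mor K a b \<otimes>\<^sub>m x = zero_mor K (a \<otimes>\<^sub>o src K x) (b \<otimes>\<^sub>o tgt K x)"
proof -
  let ?i = "idm (tgt K x)"
  have "\<forall>a \<in> ob K. \<forall>b \<in> ob K. \<forall>f \<in> Hom K a b. \<forall>g \<in> Hom K a b.
      (f \<boxplus> g) \<otimes>\<^sub>m ?i = (f \<otimes>\<^sub>m ?i) \<boxplus> (g \<otimes>\<^sub>m ?i)"
    using tensor_exact_left [of "tgt K x"] assms
    by (simp add: exact_endofunctor_def additive_endofunctor_def)
  \<comment> \<open>The sum \<open>0 + 0\<close> has to survive unsimplified, as it is the instance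
    of additivity that the next step consumes.\<close>
  then have "(zero_mor K a b \<boxplus> zero_mor K a b) \<otimes>\<^sub>m ?i =
      (zero_mor K a b \<otimes>\<^sub>m ?i) \<boxplus> (zero_mor K a b \<otimes>\<^sub>m ?i)"
    using assms by (auto simp: Hom_def simp del: add_zero)
  then have z: "zero_mor K a b \<otimes>\<^sub>m ?i = zero_mor K (a \<otimes>\<^sub>o tgt K x) (b \<otimes>\<^sub>o tgt K x)"
    by (rule additive_map_zero [where F = "\<lambda>y. y \<otimes>\<^sub>m ?i"]) (use assms in \<open>auto intro!: HomI\<close>)
  have "zero_mor K a b \<otimes>\<^sub>m x = (zero_mor K a b \<otimes>\<^sub>m ?i) \<cdot> (idm a \<otimes>\<^sub>m x)"
    using assms by simp
  then show ?thesis
    using assms by (simp add: z del: interchange)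
qed

lemma ring_prod_simps [simp]:
  assumes "ring_object K A" "ring_object K C"
  shows "under (ring_prod K A C) = dsum K (under A) (under C)"
    and "mul (ring_prod K A C) \<in> mor K"
    and "src K (mul (ring_prod K A C)) = dsum K (under A) (under C) \<otimes>\<^sub>o dsum K (under A) (under C)"
    and "tgt K (mul (ring_prod K A C)) = dsum K (under A) (under C)"
    and "unit (ring_prod K A C) \<in> mor K"
    and "src K (unit (ring_prod K A C)) = unit_ob K"
    and "tgt K (unit (ring_prod K A C)) = dsum K (under A) (under C)"
    and "ring_pr1 K A C \<cdot> mul (ring_prod K A C) = mul A \<cdot> (ring_pr1 K A C \<otimes>\<^sub>m ring_pr1 K A C)"
    and "ring_pr2 K A C \<cdot> mul (ring_prod K A C) = mul C \<cdot> (ring_pr2 K A C \<otimes>\<^sub>m ring_pr2 K A C)"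
    and "ring_pr1 K A C \<cdot> unit (ring_prod K A C) = unit A"
    and "ring_pr2 K A C \<cdot> unit (ring_prod K A C) = unit C"
  using ring_object_mor [OF assms(1)] ring_object_mor [OF assms(2)]
  by (auto simp: ring_prod_def Let_def)

lemma ring_prod_mul_comp [simp]:
  assumes "ring_object K A" "ring_object K C"
    and "x \<in> mor K" "tgt K x = dsum K (under A) (under C) \<otimes>\<^sub>o dsum K (under A) (under C)"
  shows "ring_pr1 K A C \<cdot> mul (ring_prod K A C) \<cdot> x =
      mul A \<cdot> (ring_pr1 K A C \<otimes>\<^sub>m ring_pr1 K A C) \<cdot> x"
    and "ring_pr2 K A C \<cdot> mul (ring_prod K A C) \<cdot> x =
      mul C \<cdot> (ring_pr2 K A C \<otimes>\<^sub>m ring_pr2 K A C) \<cdot> x"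
proof -
  note [simp] = ring_object_mor [OF assms(1)] ring_object_mor [OF assms(2)]
  have "(ring_pr1 K A C \<cdot> mul (ring_prod K A C)) \<cdot> x =
      (mul A \<cdot> (ring_pr1 K A C \<otimes>\<^sub>m ring_pr1 K A C)) \<cdot> x"
    using assms by (simp del: assoc)
  then show "ring_pr1 K A C \<cdot> mul (ring_prod K A C) \<cdot> x =
      mul A \<cdot> (ring_pr1 K A C \<otimes>\<^sub>m ring_pr1 K A C) \<cdot> x"
    by (subst (asm) (1 2) assoc) (use assms in simp_all)
  have "(ring_pr2 K A C \<cdot> mul (ring_prod K A C)) \<cdot> x =
      (mul C \<cdot> (ring_pr2 K A C \<otimes>\<^sub>m ring_pr2 K A C)) \<cdot> x"
    using assms by (simp del: assoc)
  then show "ring_pr2 K A C \<cdot> mul (ring_prod K A C) \<cdot> x =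
      mul C \<cdot> (ring_pr2 K A C \<otimes>\<^sub>m ring_pr2 K A C) \<cdot> x"
    by (subst (asm) (1 2) assoc) (use assms in simp_all)
qed

text \<open>The product operations are componentwise, so both laws can be compared after each
  projection.\<close>

lemma ring_obj_hom_pair:
  assumes A: "ring_object K A" and B: "ring_object K B" and C: "ring_object K C"
    and g: "ring_obj_hom K B A g" and r: "ring_obj_hom K B C r"
  shows "ring_obj_hom K B (ring_prod K A C) (dsum_pair K g r)"
proof -
  note [simp] = ring_object_mor [OF A] ring_object_mor [OF B] ring_object_mor [OF C] A C
    ring_obj_homD [OF g] ring_obj_homD [OF r]
  have "dsum_pair K g r \<cdot> mul B = mul (ring_prod K A C) \<cdot> (dsum_pair K g r \<otimes>\<^sub>m dsum_pair K g r)"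
    by (rule dsum_eqI [of "under A" "under C"]) simp_all
  moreover have "dsum_pair K g r \<cdot> unit B = unit (ring_prod K A C)"
    by (rule dsum_eqI [of "under A" "under C"]) simp_all
  ultimately show ?thesis
    by (simp add: ring_obj_hom_def Hom_def)
qed

text \<open>The equations say that \<open>s\<close>, \<open>i\<close>, \<open>g\<close>,
  \<open>r\<close> exhibit \<open>under B\<close> as a biproduct of \<open>under A\<close> and
  \<open>under C\<close>. Hence the pair \<open>(g, r)\<close> has the inverse
  \<open>s pr1 + i pr2\<close>, and the inverse of a ring homomorphism is again one.\<close>

lemma ring_obj_iso_pair:
  assumes A: "ring_object K A" and B: "ring_object K B" and C: "ring_object K C"
    and g: "ring_obj_hom K B A g" and r: "ring_obj_hom K B C r"
    and s: "s \<in> Hom K (under A) (under B)" and i: "i \<in> Hom K (under C) (under B)"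
    and gs: "g \<cdot> s = idm (under A)" and gi: "g \<cdot> i = zero_mor K (under C) (under A)"
    and rs: "r \<cdot> s = zero_mor K (under A) (under C)" and ri: "r \<cdot> i = idm (under C)"
    and sum: "(s \<cdot> g) \<boxplus> (i \<cdot> r) = idm (under B)"
  shows "ring_obj_iso K B (ring_prod K A C) (dsum_pair K g r)"
proof -
  note ty [simp] = ring_object_mor [OF A] ring_object_mor [OF B] ring_object_mor [OF C] A C
    ring_obj_homD(1-3) [OF g] ring_obj_homD(1-3) [OF r]
  have [simp]: "s \<in> mor K" "src K s = under A" "tgt K s = under B"
    "i \<in> mor K" "src K i = under C" "tgt K i = under B"
    using s i by (auto dest!: HomD)
  note [simp] = gs gi rs ri
  have [simp]: "g \<cdot> s \<cdot> x = x" "r \<cdot> s \<cdot> x = zero_mor K (src K x) (under C)"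
    if "x \<in> mor K" "tgt K x = under A" for x
    using that by (simp_all del: assoc add: assoc [symmetric])
  have [simp]: "r \<cdot> i \<cdot> x = x" "g \<cdot> i \<cdot> x = zero_mor K (src K x) (under A)"
    if "x \<in> mor K" "tgt K x = under C" for x
    using that by (simp_all del: assoc add: assoc [symmetric])
  let ?p1 = "ring_pr1 K A C" and ?p2 = "ring_pr2 K A C"
  let ?h = "dsum_pair K g r" and ?k = "(s \<cdot> ?p1) \<boxplus> (i \<cdot> ?p2)"
  have "?k \<cdot> ?h = idm (under B)"
    using sum by simp
  moreover have "?h \<cdot> ?k = idm (dsum K (under A) (under C))"
    by (rule dsum_eqI [of "under A" "under C"]) simp_all
  ultimately have inv: "inverse_mors K ?h ?k"
    by (auto simp: inverse_mors_def intro!: HomI simp del: compose_add)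
  have h: "ring_obj_hom K B (ring_prod K A C) ?h"
    using A B C g r by (rule ring_obj_hom_pair)
  have "ring_obj_hom K (ring_prod K A C) B ?k"
    by (rule ring_obj_hom_inverse [OF h inv]) simp_all
  with h inv show ?thesis
    unfolding ring_obj_iso_def by blast
qed

lemma dsum_map_pair:
  assumes "u \<in> mor K" "v \<in> mor K" "src K u = src K v" "x \<in> mor K" "y \<in> mor K"
    and "src K x = tgt K u" "src K y = tgt K v"
  shows "dsum_map K x y \<cdot> dsum_pair K u v = dsum_pair K (x \<cdot> u) (y \<cdot> v)"
  unfolding dsum_map_def
  by (rule dsum_eqI [of "tgt K x" "tgt K y"]) (use assms in simp_all)

end

section \<open>Retracts of tt-rings: the idempotent, the complement and its uniqueness\<close>

locale tt_ring_retraction = tt_category K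
  for K :: "('o, 'm, 'z) tt_category_scheme" (structure) +
  fixes A B :: "('o, 'm) ring_obj" and f g
  assumes tt_ring_A: "tt_ring K A" and tt_ring_B: "tt_ring K B"
    and f: "ring_obj_hom K A B f" and g: "ring_obj_hom K B A g"
    and gf: "g \<cdot> f = idm (under A)"
begin

lemma A: "ring_object K A" and B: "ring_object K B"
  using tt_ring_A tt_ring_B by (auto simp: tt_ring_def commutative_ring_object_def)

lemmas [simp] = ring_object_mor [OF A] ring_object_mor [OF B]
  ring_obj_homD(1-3) [OF f] ring_obj_homD(1-3) [OF g] gf

lemma g_f_comp [simp]: "x \<in> mor K \<Longrightarrow> tgt K x = under A \<Longrightarrow> g \<cdot> f \<cdot> x = x"
  by (simp del: assoc add: assoc [symmetric])

text \<open>In elements, let \<open>\<sigma>(1)\<close> be the sum of the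
  \<open>x_i \<otimes> y_i\<close> and put \<open>k = f g\<close>. Left linearity of
  \<open>\<sigma>\<close> gives \<open>t(b) = b t(1)\<close>, where \<open>t(1)\<close> is the sum
  of the \<open>x_i k(y_i)\<close>; right linearity gives \<open>t(b) = t(1) k(b)\<close>. The first
  is the linearity claimed, the second yields \<open>t k = t\<close> since \<open>k\<close> is
  idempotent, and \<open>g k = g\<close> yields \<open>g t = g\<close>.\<close>

lemma ex_linear_idempotent:
  obtains t where "t \<in> mor K" "src K t = under B" "tgt K t = under B"
    "g \<cdot> t = g" "t \<cdot> f \<cdot> g = t" "t \<cdot> mul B = mul B \<cdot> (idm (under B) \<otimes>\<^sub>m t)"
proof -
  let ?I = "idm (under B)" and ?a = "associator K (under B) (under B) (under B)"
  let ?m = "mul B"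
  obtain s where s: "bimodule_hom K B (regular_bimodule B) (tensor_bimodule K B) s"
    and ms: "?m \<cdot> s = ?I"
    using tt_ring_B by (auto simp: tt_ring_def separable_def)
  have s_mor [simp]: "s \<in> mor K" "src K s = under B" "tgt K s = under B \<otimes>\<^sub>o under B"
    and sl: "s \<cdot> ?m = (?m \<otimes>\<^sub>m ?I) \<cdot> inv_mor K ?a \<cdot> (?I \<otimes>\<^sub>m s)"
    and sr: "s \<cdot> ?m = (?I \<otimes>\<^sub>m ?m) \<cdot> ?a \<cdot> (s \<otimes>\<^sub>m ?I)"
    using s by (auto simp: bimodule_hom_def regular_bimodule_def tensor_bimodule_def dest!: HomD)
  \<comment> \<open>As \<open>g f = 1\<close>, this is an idempotent ring endomorphism of
    \<open>B\<close> with \<open>g k = g\<close>.\<close>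
  define k where "k = f \<cdot> g"
  have "ring_obj_hom K B B k"
    unfolding k_def using B A B g f by (rule ring_obj_hom_comp)
  note k_mul = ring_obj_homD(4) [OF this]
  have k [simp]: "k \<in> mor K" "src K k = under B" "tgt K k = under B" "k \<cdot> k = k" "g \<cdot> k = g"
    by (simp_all add: k_def)
  define t where "t = ?m \<cdot> (?I \<otimes>\<^sub>m k) \<cdot> s"
  have t [simp]: "t \<in> mor K" "src K t = under B" "tgt K t = under B"
    by (simp_all add: t_def)
  have "t \<cdot> ?m = ?m \<cdot> (?I \<otimes>\<^sub>m k) \<cdot> (s \<cdot> ?m)"
    by (simp add: t_def)
  also have "\<dots> = ?m \<cdot> (?m \<otimes>\<^sub>m k) \<cdot> inv_mor K ?a \<cdot> (?I \<otimes>\<^sub>m s)"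
    unfolding sl by simp
  also have "\<dots> = (?m \<cdot> (?m \<otimes>\<^sub>m ?I)) \<cdot> (((?I \<otimes>\<^sub>m ?I) \<otimes>\<^sub>m k) \<cdot> inv_mor K ?a) \<cdot> (?I \<otimes>\<^sub>m s)"
    by simp
  also have "\<dots> = (?m \<cdot> (?I \<otimes>\<^sub>m ?m) \<cdot> ?a) \<cdot> (inv_mor K ?a \<cdot> (?I \<otimes>\<^sub>m (?I \<otimes>\<^sub>m k))) \<cdot> (?I \<otimes>\<^sub>m s)"
    by (subst inv_associator_nat) (simp_all only: ring_object_laws(1) [OF B] ident_mor k t B
        ring_object_mor [OF B])
  also have "\<dots> = ?m \<cdot> (?I \<otimes>\<^sub>m t)"
    by (simp add: t_def)
  finally have left: "t \<cdot> ?m = ?m \<cdot> (?I \<otimes>\<^sub>m t)" .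
  \<comment> \<open>The right action puts the second argument into the right tensor factor, where
    the multiplicative map \<open>k\<close> is applied: \<open>t(b c) = t(b) k(c)\<close>.\<close>
  have "t \<cdot> ?m = ?m \<cdot> (?I \<otimes>\<^sub>m k) \<cdot> (s \<cdot> ?m)"
    by (simp add: t_def)
  also have "\<dots> = ?m \<cdot> (?I \<otimes>\<^sub>m (k \<cdot> ?m)) \<cdot> ?a \<cdot> (s \<otimes>\<^sub>m ?I)"
    unfolding sr by simp
  also have "\<dots> = ?m \<cdot> (?I \<otimes>\<^sub>m ?m) \<cdot> ((?I \<otimes>\<^sub>m (k \<otimes>\<^sub>m k)) \<cdot> ?a) \<cdot> (s \<otimes>\<^sub>m ?I)"
    by (simp add: k_mul)
  also have "\<dots> = (?m \<cdot> (?I \<otimes>\<^sub>m ?m) \<cdot> ?a) \<cdot> (((?I \<otimes>\<^sub>m k) \<cdot> s) \<otimes>\<^sub>m k)"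
    by (subst associator_nat) simp_all
  also have "\<dots> = ?m \<cdot> (t \<otimes>\<^sub>m k)"
    by (simp only: ring_object_laws(1) [OF B, symmetric]) (simp add: t_def)
  finally have right: "t \<cdot> ?m = ?m \<cdot> (t \<otimes>\<^sub>m k)" .
  \<comment> \<open>Moving \<open>g\<close> through the multiplication makes \<open>k\<close>
    disappear and leaves \<open>g m s = g\<close>.\<close>
  have "g \<cdot> t = (g \<cdot> ?m) \<cdot> (?I \<otimes>\<^sub>m k) \<cdot> s"
    by (simp add: t_def)
  also have "\<dots> = (mul A \<cdot> (g \<otimes>\<^sub>m g)) \<cdot> s"
    by (simp only: ring_obj_homD(4) [OF g]) simp
  also have "\<dots> = g \<cdot> ?m \<cdot> s"
    by (simp only: ring_obj_homD(4) [OF g, symmetric]) simp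
  finally have gt: "g \<cdot> t = g"
    by (simp add: ms)
  let ?l = "lunitor K (under B)"
  \<comment> \<open>Precomposing with the unitor amounts to writing \<open>b = 1 b\<close>, so this
    is \<open>t(b) = t(1) k(b)\<close>.\<close>
  have tl: "t \<cdot> ?l = ?m \<cdot> ((t \<cdot> unit B) \<otimes>\<^sub>m k)"
  proof -
    have "t \<cdot> ?l = (t \<cdot> ?m) \<cdot> (unit B \<otimes>\<^sub>m ?I)"
      by (simp add: ring_object_laws(2) [OF B])
    then show ?thesis
      by (simp add: right)
  qed
  have "t \<cdot> k = t"
  proof (rule compose_cancel_split_epi [of _ ?l _ "inv_mor K ?l"])
    have "(t \<cdot> k) \<cdot> ?l = (t \<cdot> ?l) \<cdot> (idm (unit_ob K) \<otimes>\<^sub>m k)"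
      using lunitor_natural [OF mor_Hom [of k]] by simp
    also have "\<dots> = t \<cdot> ?l"
      by (simp add: tl)
    finally show "(t \<cdot> k) \<cdot> ?l = t \<cdot> ?l" .
  qed (use inv_mor_inverse [OF lunitor_iso [of "under B"]]
      in \<open>auto simp: inverse_mors_def dest!: HomD\<close>)
  then have "t \<cdot> f \<cdot> g = t"
    by (simp add: k_def)
  with t gt show thesis
    using left by (rule that)
qed

text \<open>The maps are \<open>s = t f\<close> and a splitting \<open>r\<close>, \<open>i\<close>
  of \<open>p = 1 - t\<close>. The conclusion records the biproduct relations that make
  \<open>(g, r)\<close> invertible and, in its last clause, the linearity of \<open>s g = t\<close>,
  on which uniqueness rests.\<close>

lemma ex_complement_ring:
  obtains C r i s where "tt_ring K C" "ring_obj_hom K B C r"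
    "i \<in> Hom K (under C) (under B)" "s \<in> Hom K (under A) (under B)"
    "g \<cdot> s = idm (under A)" "g \<cdot> i = zero_mor K (under C) (under A)"
    "r \<cdot> s = zero_mor K (under A) (under C)" "r \<cdot> i = idm (under C)"
    "(s \<cdot> g) \<boxplus> (i \<cdot> r) = idm (under B)"
    "(s \<cdot> g) \<cdot> mul B = mul B \<cdot> (idm (under B) \<otimes>\<^sub>m (s \<cdot> g))"
proof -
  let ?I = "idm (under B)" and ?m = "mul B" and ?c = "symmetry K (under B) (under B)"
  obtain t where t [simp]: "t \<in> mor K" "src K t = under B" "tgt K t = under B"
    and gt [simp]: "g \<cdot> t = g" and tfg [simp]: "t \<cdot> f \<cdot> g = t"
    and tm: "t \<cdot> ?m = ?m \<cdot> (?I \<otimes>\<^sub>m t)"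
    by (rule ex_linear_idempotent)
  \<comment> \<open>\<open>t\<close> factors through \<open>g\<close>, and \<open>g\<close> absorbs
    \<open>t\<close>.\<close>
  have tt: "t \<cdot> t = t"
  proof -
    have "t \<cdot> t = (t \<cdot> f \<cdot> g) \<cdot> t"
      by (simp only: tfg)
    also have "\<dots> = t \<cdot> f \<cdot> (g \<cdot> t)"
      by (simp del: tfg gt)
    also have "\<dots> = t"
      by simp
    finally show ?thesis .
  qed
  obtain p where p [simp]: "p \<in> mor K" "src K p = under B" "tgt K p = under B"
    and tp: "t \<boxplus> p = ?I"
    using ex_complement [of t ?I] by auto
  \<comment> \<open>The relations for \<open>p\<close> come from composing \<open>t + p = 1\<close>
    with \<open>t\<close>, \<open>p\<close> or \<open>g\<close>.\<close>
  have "t \<boxplus> (t \<cdot> p) = t \<cdot> (t \<boxplus> p)"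
    by (simp add: tt)
  also have "\<dots> = t \<boxplus> zero_mor K (under B) (under B)"
    by (simp add: tp del: compose_add)
  finally have tp0: "t \<cdot> p = zero_mor K (under B) (under B)"
    by (rule add_cancel_left) simp_all
  have "t \<boxplus> (p \<cdot> t) = (t \<boxplus> p) \<cdot> t"
    by (simp add: tt)
  also have "\<dots> = t \<boxplus> zero_mor K (under B) (under B)"
    by (simp add: tp del: compose_add)
  finally have pt0: "p \<cdot> t = zero_mor K (under B) (under B)"
    by (rule add_cancel_left) simp_all
  have "p \<cdot> p = (t \<boxplus> p) \<cdot> p"
    by (simp add: tp0)
  then have pp: "p \<cdot> p = p"
    by (simp add: tp del: compose_add)
  have "g \<boxplus> (g \<cdot> p) = g \<cdot> (t \<boxplus> p)"
    by (simp add: tt)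
  also have "\<dots> = g \<boxplus> zero_mor K (under B) (under A)"
    by (simp add: tp del: compose_add)
  finally have gp: "g \<cdot> p = zero_mor K (under B) (under A)"
    by (rule add_cancel_left) simp_all
  have pm: "p \<cdot> ?m = ?m \<cdot> (?I \<otimes>\<^sub>m p)"
  proof (rule add_cancel_left [of "t \<cdot> ?m"])
    have "(t \<cdot> ?m) \<boxplus> (p \<cdot> ?m) = (t \<boxplus> p) \<cdot> ?m"
      by simp
    also have "\<dots> = ?m \<cdot> (?I \<otimes>\<^sub>m (t \<boxplus> p))"
      by (simp add: tp del: compose_add)
    also have "\<dots> = (t \<cdot> ?m) \<boxplus> (?m \<cdot> (?I \<otimes>\<^sub>m p))"
      by (simp add: tensor_add_right tm)
    finally show "(t \<cdot> ?m) \<boxplus> (p \<cdot> ?m) = (t \<cdot> ?m) \<boxplus> (?m \<cdot> (?I \<otimes>\<^sub>m p))" .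
  qed simp_all
  have comm: "?m \<cdot> ?c = ?m"
    using tt_ring_B by (simp add: tt_ring_def commutative_ring_object_def)
  \<comment> \<open>Commutativity moves linearity to the other factor; multiplicativity of
    \<open>r\<close> uses both forms.\<close>
  have pm': "p \<cdot> ?m = ?m \<cdot> (p \<otimes>\<^sub>m ?I)"
  proof -
    have "p \<cdot> ?m = (p \<cdot> ?m) \<cdot> ?c"
      by (simp add: comm)
    also have "\<dots> = ?m \<cdot> (?I \<otimes>\<^sub>m p) \<cdot> ?c"
      by (simp only: pm) simp
    also have "\<dots> = (?m \<cdot> ?c) \<cdot> (p \<otimes>\<^sub>m ?I)"
      using symmetry_natural [OF mor_Hom [of p] mor_Hom [of ?I]] by simp
    finally show ?thesis
      by (simp only: comm)
  qed
  have "p \<in> Hom K (under B) (under B)"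
    by (simp add: Hom_def)
  then obtain c r i where c [simp]: "c \<in> ob K" and rH: "r \<in> Hom K (under B) c"
    and iH: "i \<in> Hom K c (under B)" and ir: "i \<cdot> r = p" and ri [simp]: "r \<cdot> i = idm c"
    using idempotent_complete pp ring_object_mor(1) [OF B] unfolding idempotent_complete_def by blast
  have [simp]: "r \<in> mor K" "src K r = under B" "tgt K r = c"
    "i \<in> mor K" "src K i = c" "tgt K i = under B"
    using rH iH by (auto dest!: HomD)
  have ri_comp [simp]: "r \<cdot> i \<cdot> x = x" if "x \<in> mor K" "tgt K x = c" for x
    using that by (simp del: assoc add: assoc [symmetric])
  have pi: "p \<cdot> i = i" and rp: "r \<cdot> p = r"
    by (simp_all add: ir [symmetric])
  \<comment> \<open>The ideal \<open>p(B)\<close>, with multiplication restricted along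
    \<open>i\<close> and with unit \<open>r(1)\<close>, which corresponds to the idempotent element
    \<open>p(1)\<close> of \<open>B\<close>.\<close>
  define C :: "('o, 'm) ring_obj"
    where "C = \<lparr>under = c, mul = r \<cdot> ?m \<cdot> (i \<otimes>\<^sub>m i), unit = r \<cdot> unit B\<rparr>"
  have C [simp]: "under C = c" "mul C = r \<cdot> ?m \<cdot> (i \<otimes>\<^sub>m i)" "unit C = r \<cdot> unit B"
    by (simp_all add: C_def)
  \<comment> \<open>The two forms of linearity give \<open>p(x) p(y) = p(p(x y))\<close>, and
    \<open>r p = r\<close>.\<close>
  have "mul C \<cdot> (r \<otimes>\<^sub>m r) = r \<cdot> ?m \<cdot> (p \<otimes>\<^sub>m p)"
    by (simp add: ir)
  also have "\<dots> = r \<cdot> (?m \<cdot> (p \<otimes>\<^sub>m ?I)) \<cdot> (?I \<otimes>\<^sub>m p)"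
    by simp
  also have "\<dots> = (r \<cdot> p) \<cdot> ?m \<cdot> (?I \<otimes>\<^sub>m p)"
    by (simp only: pm' [symmetric]) simp
  also have "\<dots> = (r \<cdot> p) \<cdot> ?m"
    by (simp only: rp pm [symmetric]) (simp del: assoc add: assoc [symmetric] rp)
  finally have r_mul: "r \<cdot> ?m = mul C \<cdot> (r \<otimes>\<^sub>m r)"
    by (simp only: rp)
  have r: "ring_obj_hom K B C r"
    using r_mul by (simp add: ring_obj_hom_def Hom_def)
  interpret split_ring_quotient K B C r i
    by unfold_locales (use B r in \<open>simp_all add: Hom_def\<close>)
  \<comment> \<open>A product of elements of the ideal stays in it: \<open>p\<close> fixes
    \<open>i(x) i(y)\<close> because \<open>p\<close> is linear and \<open>p i = i\<close>.\<close>
  have "i \<cdot> mul C = (i \<cdot> r) \<cdot> ?m \<cdot> (i \<otimes>\<^sub>m i)"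
    by simp
  also have "\<dots> = (p \<cdot> ?m) \<cdot> (i \<otimes>\<^sub>m i)"
    by (simp only: ir) simp
  also have "\<dots> = ?m \<cdot> (i \<otimes>\<^sub>m i)"
    by (simp only: pm) (simp add: pi)
  finally have "separable K C"
    using tt_ring_B by (intro separable) (auto simp: tt_ring_def)
  then have "tt_ring K C"
    using commutative_ring_object tt_ring_B by (simp add: tt_ring_def)
  moreover have "g \<cdot> t \<cdot> f = idm (under A)"
    using gf gt by (simp del: assoc gt add: assoc [symmetric])
  moreover have "g \<cdot> i = zero_mor K c (under A)"
  proof -
    have "g \<cdot> i = (g \<cdot> p) \<cdot> i"
      by (simp add: pi)
    then show ?thesis
      by (simp only: gp) simp
  qed
  moreover have "r \<cdot> t \<cdot> f = zero_mor K (under A) c"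
  proof -
    have "r \<cdot> t \<cdot> f = r \<cdot> (p \<cdot> t) \<cdot> f"
      by (simp add: ir [symmetric])
    then show ?thesis
      by (simp only: pt0) simp
  qed
  ultimately show thesis
    using r tp tm iH
    by (intro that [of C r i "t \<cdot> f"]) (simp_all add: ir Hom_def)
qed

text \<open>Let \<open>r'\<close> be the second component of \<open>h'\<close>. Since
  \<open>r' s = 0\<close>, the relation \<open>s g + i r = 1\<close> gives
  \<open>r' = (r' i) r\<close>, so \<open>l = r' i\<close> is the comparison map. With
  \<open>i'\<close> the inclusion of \<open>C'\<close> transported to \<open>B\<close>, the
  relations \<open>s' g + i' r' = 1\<close> and \<open>g i = 0\<close> show that \<open>r i'\<close>
  is inverse to \<open>l\<close>.\<close>

lemma complement_unique:
  assumes C: "tt_ring K C" and r: "ring_obj_hom K B C r"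
    and i: "i \<in> Hom K (under C) (under B)" and s: "s \<in> Hom K (under A) (under B)"
    and gi: "g \<cdot> i = zero_mor K (under C) (under A)" and ri: "r \<cdot> i = idm (under C)"
    and sum: "(s \<cdot> g) \<boxplus> (i \<cdot> r) = idm (under B)"
    and linear: "(s \<cdot> g) \<cdot> mul B = mul B \<cdot> (idm (under B) \<otimes>\<^sub>m (s \<cdot> g))"
    and C': "tt_algebra K A C' c'"
    and h': "algebra_iso K (B, f) (prod_algebra K A (C', c')) h'"
    and pr1: "ring_pr1 K A C' \<cdot> h' = g"
  shows "\<exists>l. algebra_iso K (C, r \<cdot> f) (C', c') l \<and>
    h' = dsum_map K (idm (under A)) l \<cdot> dsum_pair K g r"
proof -
  have C_ring: "ring_object K C" and C'_ring: "ring_object K C'"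
    and c': "ring_obj_hom K A C' c'"
    using C C' by (auto simp: tt_algebra_def tt_ring_def commutative_ring_object_def)
  note [simp] = A C'_ring ring_object_mor [OF C_ring] ring_object_mor [OF C'_ring]
    ring_obj_homD(1-3) [OF r] ring_obj_homD(1-3) [OF c']
  have [simp]: "i \<in> mor K" "src K i = under C" "tgt K i = under B"
    "s \<in> mor K" "src K s = under A" "tgt K s = under B"
    using i s by (auto dest!: HomD)
  note [simp] = gi ri
  let ?a = "under A" and ?c = "under C'"
  let ?p1 = "ring_pr1 K A C'" and ?p2 = "ring_pr2 K A C'"
  have h'_hom: "ring_obj_hom K B (ring_prod K A C') h'" and h'f: "h' \<cdot> f = dsum_pair K (idm ?a) c'"
    using h' by (auto simp: algebra_iso_def algebra_hom_def prod_algebra_def)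
  note [simp] = ring_obj_homD [OF h'_hom]
  obtain k' where "inverse_mors K h' k'"
    using h' by (auto simp: algebra_iso_def)
  then have k' [simp]: "k' \<in> mor K" "src K k' = dsum K ?a ?c" "tgt K k' = under B"
    "h' \<cdot> k' = idm (dsum K ?a ?c)" "k' \<cdot> h' = idm (under B)"
    by (auto simp: inverse_mors_def dest!: HomD)
  have h'k' [simp]: "h' \<cdot> k' \<cdot> x = x" if "x \<in> mor K" "tgt K x = dsum K ?a ?c" for x
    using that by (simp del: assoc add: assoc [symmetric])
  define r' where "r' = ?p2 \<cdot> h'"
  have r' [simp]: "r' \<in> mor K" "src K r' = under B" "tgt K r' = ?c"
    by (simp_all add: r'_def)
  have r'_mul: "r' \<cdot> mul B = mul C' \<cdot> (r' \<otimes>\<^sub>m r')" and r'_unit: "r' \<cdot> unit B = unit C'"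
    by (simp_all add: r'_def)
  have r'f: "r' \<cdot> f = c'"
    by (simp add: r'_def h'f)
  \<comment> \<open>Inclusions of the summands, transported to \<open>B\<close> along the inverse of
    \<open>h'\<close>; together with \<open>g\<close> and \<open>r'\<close> they form a
    biproduct.\<close>
  define s' where "s' = k' \<cdot> dsum_in1 K ?a ?c"
  define i' where "i' = k' \<cdot> dsum_in2 K ?a ?c"
  have [simp]: "s' \<in> mor K" "src K s' = ?a" "tgt K s' = under B"
    "i' \<in> mor K" "src K i' = ?c" "tgt K i' = under B"
    by (simp_all add: s'_def i'_def)
  have r's' [simp]: "r' \<cdot> s' = zero_mor K ?a ?c" and r'i' [simp]: "r' \<cdot> i' = idm ?c"
    by (simp_all add: r'_def s'_def i'_def)
  have gs' [simp]: "g \<cdot> s' = idm ?a"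
    by (simp add: pr1 [symmetric] s'_def)
  have sum': "(s' \<cdot> g) \<boxplus> (i' \<cdot> r') = idm (under B)"
  proof -
    have "(s' \<cdot> g) \<boxplus> (i' \<cdot> r') =
        k' \<cdot> ((dsum_in1 K ?a ?c \<cdot> ?p1) \<boxplus> (dsum_in2 K ?a ?c \<cdot> ?p2)) \<cdot> h'"
      by (simp add: s'_def i'_def r'_def pr1 del: dsum_simps(18))
    then show ?thesis
      by (simp del: compose_add)
  qed
  \<comment> \<open>In elements: \<open>r'(s(a)) = r'(t(s'(a) \<cdot> 1)) = r'(s'(a)) \<cdot> r'(t(1)) = 0\<close>.\<close>
  have r's: "r' \<cdot> s = zero_mor K ?a ?c"
  proof (rule compose_cancel_split_epi [of _ "runitor K ?a" _ "inv_mor K (runitor K ?a)"])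
    have "(r' \<cdot> s) \<cdot> runitor K ?a = r' \<cdot> s \<cdot> (g \<cdot> s') \<cdot> runitor K ?a"
      by simp
    also have "\<dots> = r' \<cdot> (s \<cdot> g) \<cdot> runitor K (under B) \<cdot> (s' \<otimes>\<^sub>m idm (unit_ob K))"
      using runitor_natural [OF mor_Hom [of s']] by (simp del: gs')
    also have "\<dots> = r' \<cdot> ((s \<cdot> g) \<cdot> mul B) \<cdot> (s' \<otimes>\<^sub>m unit B)"
      by (simp add: ring_object_laws(3) [OF B, symmetric])
    also have "\<dots> = (r' \<cdot> mul B) \<cdot> (s' \<otimes>\<^sub>m (s \<cdot> g \<cdot> unit B))"
      by (simp only: linear) simp
    also have "\<dots> = zero_mor K ?a ?c \<cdot> runitor K ?a"
      by (simp only: r'_mul) (simp add: tensor_zero_left)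
    finally show "(r' \<cdot> s) \<cdot> runitor K ?a = zero_mor K ?a ?c \<cdot> runitor K ?a" .
  qed (use inv_mor_inverse [OF runitor_iso [of ?a]]
      in \<open>auto simp: inverse_mors_def dest!: HomD\<close>)
  have r's_comp [simp]: "r' \<cdot> s \<cdot> g = zero_mor K (under B) ?c"
    using r's by (simp del: assoc add: assoc [symmetric])
  define l where "l = r' \<cdot> i"
  have l [simp]: "l \<in> mor K" "src K l = under C" "tgt K l = ?c"
    by (simp_all add: l_def)
  have lr: "l \<cdot> r = r'"
  proof -
    have "l \<cdot> r = r' \<cdot> ((s \<cdot> g) \<boxplus> (i \<cdot> r))"
      by (simp add: l_def)
    then show ?thesis
      by (simp add: sum del: compose_add)
  qed
  have li: "l \<cdot> r \<cdot> i' = idm ?c"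
  proof -
    have "l \<cdot> r \<cdot> i' = (l \<cdot> r) \<cdot> i'"
      by simp
    then show ?thesis
      by (simp only: lr) simp
  qed
  have il: "(r \<cdot> i') \<cdot> l = idm (under C)"
  proof -
    have "(r \<cdot> i') \<cdot> l = r \<cdot> ((s' \<cdot> g) \<boxplus> (i' \<cdot> r')) \<cdot> i"
      by (simp add: l_def)
    then show ?thesis
      by (simp add: sum' del: compose_add)
  qed
  have inv: "inverse_mors K l (r \<cdot> i')"
    using li il by (simp add: inverse_mors_def Hom_def)
  \<comment> \<open>\<open>l r = r'\<close> is multiplicative, and so is \<open>r\<close>; hence the
    equation holds after the split epimorphism \<open>r \<otimes> r\<close>.\<close>
  have "l \<cdot> mul C = mul C' \<cdot> (l \<otimes>\<^sub>m l)"
  proof (rule compose_cancel_split_epi [of _ "r \<otimes>\<^sub>m r" _ "i \<otimes>\<^sub>m i"])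
    have "(l \<cdot> mul C) \<cdot> (r \<otimes>\<^sub>m r) = (l \<cdot> r) \<cdot> mul B"
      by (simp add: ring_obj_homD(4) [OF r])
    also have "\<dots> = (mul C' \<cdot> (l \<otimes>\<^sub>m l)) \<cdot> (r \<otimes>\<^sub>m r)"
      by (simp only: lr) (simp add: r'_mul lr)
    finally show "(l \<cdot> mul C) \<cdot> (r \<otimes>\<^sub>m r) = (mul C' \<cdot> (l \<otimes>\<^sub>m l)) \<cdot> (r \<otimes>\<^sub>m r)" .
  qed simp_all
  moreover have "l \<cdot> unit C = unit C'"
  proof -
    have "l \<cdot> unit C = (l \<cdot> r) \<cdot> unit B"
      by (simp add: ring_obj_homD(5) [OF r])
    then show ?thesis
      by (simp only: lr r'_unit)
  qed
  ultimately have l_hom: "ring_obj_hom K C C' l"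
    by (simp add: ring_obj_hom_def Hom_def)
  have lrf: "l \<cdot> r \<cdot> f = c'"
  proof -
    have "l \<cdot> r \<cdot> f = (l \<cdot> r) \<cdot> f"
      by simp
    then show ?thesis
      by (simp only: lr r'f)
  qed
  \<comment> \<open>The inverse respects the structure maps because \<open>c' = l r f\<close> and
    \<open>(r i') l = 1\<close>.\<close>
  have "(r \<cdot> i') \<cdot> c' = ((r \<cdot> i') \<cdot> l) \<cdot> r \<cdot> f"
    unfolding lrf [symmetric] by simp
  then have "(r \<cdot> i') \<cdot> c' = r \<cdot> f"
    by (simp only: il) simp
  moreover have "ring_obj_hom K C' C (r \<cdot> i')"
    by (rule ring_obj_hom_inverse [OF l_hom inv]) simp_all
  ultimately have "algebra_iso K (C, r \<cdot> f) (C', c') l"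
    using l_hom lrf inv by (auto simp: algebra_iso_def algebra_hom_def)
  \<comment> \<open>Both sides have first component \<open>g\<close> and second component
    \<open>l r = r'\<close>.\<close>
  moreover have "h' = dsum_map K (idm ?a) l \<cdot> dsum_pair K g r"
    by (rule dsum_eqI [of ?a ?c]) (simp_all add: dsum_map_pair pr1 lr r'_def [symmetric])
  ultimately show ?thesis
    by blast
qed

end

section \<open>Assembly of the splitting with its uniqueness\<close>

theorem theorem2p1:
  fixes K :: "('o, 'm) tt_category"
    and A B :: "('o, 'm) ring_obj"
    and f g :: 'm
  assumes "tt_category K"
    and "tt_ring K A" and "tt_ring K B"
    and "ring_obj_hom K A B f" and "ring_obj_hom K B A g"
    and "g \<cdot>\<^bsub>K\<^esub> f = idm\<^bsub>K\<^esub> (under A)"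
  shows "\<exists>C h. tt_ring K C \<and> ring_obj_iso K B (ring_prod K A C) h \<and> ring_pr1 K A C \<cdot>\<^bsub>K\<^esub> h = g \<and>
    tt_algebra K A C (ring_pr2 K A C \<cdot>\<^bsub>K\<^esub> h \<cdot>\<^bsub>K\<^esub> f) \<and>
    (\<forall>C' c' h'. tt_algebra K A C' c' \<and>
       algebra_iso K (B, f) (prod_algebra K A (C', c')) h' \<and> ring_pr1 K A C' \<cdot>\<^bsub>K\<^esub> h' = g \<longrightarrow>
       (\<exists>l. algebra_iso K (C, ring_pr2 K A C \<cdot>\<^bsub>K\<^esub> h \<cdot>\<^bsub>K\<^esub> f) (C', c') l \<and>
         h' = dsum_map K (idm\<^bsub>K\<^esub> (under A)) l \<cdot>\<^bsub>K\<^esub> h))"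
proof -
  interpret tt_ring_retraction K A B f g
    using assms by (intro tt_ring_retraction.intro tt_ring_retraction_axioms.intro)
  obtain C r i s where C: "tt_ring K C" and r: "ring_obj_hom K B C r"
    and i: "i \<in> Hom K (under C) (under B)" and s: "s \<in> Hom K (under A) (under B)"
    and gs: "g \<cdot>\<^bsub>K\<^esub> s = idm\<^bsub>K\<^esub> (under A)" and gi: "g \<cdot>\<^bsub>K\<^esub> i = zero_mor K (under C) (under A)"
    and rs: "r \<cdot>\<^bsub>K\<^esub> s = zero_mor K (under A) (under C)" and ri: "r \<cdot>\<^bsub>K\<^esub> i = idm\<^bsub>K\<^esub> (under C)"
    and sum: "(s \<cdot>\<^bsub>K\<^esub> g) \<boxplus>\<^bsub>K\<^esub> (i \<cdot>\<^bsub>K\<^esub> r) = idm\<^bsub>K\<^esub> (under B)"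
    and linear: "(s \<cdot>\<^bsub>K\<^esub> g) \<cdot>\<^bsub>K\<^esub> mul B = mul B \<cdot>\<^bsub>K\<^esub> (idm\<^bsub>K\<^esub> (under B) \<otimes>\<^sub>m\<^bsub>K\<^esub> (s \<cdot>\<^bsub>K\<^esub> g))"
    by (rule ex_complement_ring)
  have C_ring: "ring_object K C"
    using C by (simp add: tt_ring_def commutative_ring_object_def)
  note [simp] = ring_object_mor [OF C_ring] ring_obj_homD(1-3) [OF r]
  let ?h = "dsum_pair K g r"
  \<comment> \<open>This identifies the structure map that the statement puts on \<open>C\<close>
    with \<open>r f\<close>, the form in which \<open>complement_unique\<close> is stated.\<close>
  have pr2: "ring_pr2 K A C \<cdot>\<^bsub>K\<^esub> ?h \<cdot>\<^bsub>K\<^esub> f = r \<cdot>\<^bsub>K\<^esub> f"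
    by simp
  have "ring_obj_iso K B (ring_prod K A C) ?h"
    using A B C_ring g r s i gs gi rs ri sum by (rule ring_obj_iso_pair)
  moreover have "ring_pr1 K A C \<cdot>\<^bsub>K\<^esub> ?h = g"
    by simp
  moreover have "tt_algebra K A C (r \<cdot>\<^bsub>K\<^esub> f)"
    using C ring_obj_hom_comp [OF A B C_ring f r] by (simp add: tt_algebra_def)
  ultimately show ?thesis
    using C complement_unique [OF C r i s gi ri sum linear]
    by (intro exI [of _ C] exI [of _ ?h]) (simp only: pr2, blast)
qed

end
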